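(* Assume that the field $\Bbbk$ contains a primitive $6$-th root of unity $\zeta$, and let $A$ be the $24$-dimensional Hopf algebra $\Bbbk\langle a,b,x\mid a^2=1=b^6,\ x^2=0,\ ab=ba,\ ax=xa,\ bx=-xb\rangle$ with the bilinear form $\langle y,z\rangle=\lambda(zS(y))$. Let $c\in R$ be an invertible element, and let $s,t,m$ be integers with $0\le m,s\le1$, $0\le t\le5$. Then the left and right orthogonals of $N_{s,t,m}$ coincide, and likewise those of $cN_{s,t,m}$ (write $\perp$ for both), and $$N_{s,t,0}^{\perp}=\Big(\bigoplus_{0\le j\le5}N_{1-s,j,0}\Big)\oplus\Big(\bigoplus_{\substack{0\le j\le5\\ j\not\equiv(-1)^{s+1}t+3\ (\mathrm{mod}\ 6)}}N_{s,j,0}\Big),$$ $$N_{s,t,m}^{\perp}=N_{s,t,0}^{\perp}\oplus N_{s,(-1)^{s+1}t+3,2-m},\qquad (cN_{s,t,m})^{\perp}=S(c^{-1})N_{s,t,m}^{\perp}.$$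
   Context: Put $e_0=\frac12(1+a)$, $e_1=\frac12(1-a)$, $f_j=\frac16\sum_{i=0}^5\zeta^{ji}b^i$ for $j\in\mathbb{Z}$ (depends only on $j$ mod $6$), $e_{i,j}:=e_if_j$. The Hopf structure of $A$ is $\Delta(a)=a\otimes a$, $\Delta(b)=b\otimes e_0b+b^{-1}\otimes e_1b$, $\Delta(x)=b^3\otimes x+x\otimes1$, $\varepsilon(a)=\varepsilon(b)=1$, $\varepsilon(x)=0$, with antipode $S(a)=a$, $S(b)=e_0b^{-1}+e_1b$, $S(x)=-b^3x=xb^3$. $A$ has basis $\{x^ma^ib^j\mid0\le m,i\le1,\ 0\le j\le5\}$. $R$ is the subalgebra generated by $x$, and $N_{s,t,m}:=e_{s,t}x^mR$ for $s\in\{0,1\}$, $t\in\mathbb{Z}$, $0\le m\le2$ (so $N_{s,t,2}=0$). $\lambda\in A^*$ is the left integral given on this basis by $\lambda(x^ma^ib^j)=\delta_{m,1}\delta_{i,0}\delta_{j,3}$. For a subspace $W$ of $A$, $W^{\perp_L}:=\{v\in A\mid\langle v,w\rangle=0\ \forall w\in W\}$ and $W^{\perp_R}:=\{v\in A\mid\langle w,v\rangle=0\ \forall w\in W\}$; $W^\perp$ is written when the two coincide. *)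

theory Defs
  imports Complex_Main "HOL-Library.Poly_Mapping" "HOL-Number_Theory.Cong"
begin

section \<open>The free algebra on three generators\<close>

datatype gen = Ga | Gb | Gx

text \<open>
  Words are written additively only because \<open>Poly_Mapping\<close> equips \<open>'m \<Rightarrow>\<^sub>0 'k\<close> with the
  convolution product for \<open>'m :: monoid_add\<close>; with \<open>+\<close> being concatenation,
  \<open>word \<Rightarrow>\<^sub>0 'k\<close> is the free associative unital algebra on \<open>gen\<close>.
\<close>

datatype word = Word (letters: "gen list")

instantiation word :: monoid_add
begin

definition zero_word :: word where "0 = Word []"

definition plus_word :: "word \<Rightarrow> word \<Rightarrow> word" where "v + w = Word (letters v @ letters w)"

instance
  by standard (simp_all add: zero_word_def plus_word_def)

end

definition wmon :: "word \<Rightarrow> (word \<Rightarrow>\<^sub>0 'k::field)" where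
  "wmon w = Poly_Mapping.single w 1"

definition var :: "gen \<Rightarrow> (word \<Rightarrow>\<^sub>0 'k::field)" where
  "var g = wmon (Word [g])"

definition scal :: "'k \<Rightarrow> (word \<Rightarrow>\<^sub>0 'k::field)" where
  "scal r = Poly_Mapping.single 0 r"

inductive_set two_sided_ideal :: "'r::ring_1 set \<Rightarrow> 'r set" for G where
  zero: "0 \<in> two_sided_ideal G"
| gen: "g \<in> G \<Longrightarrow> u * g * v \<in> two_sided_ideal G"
| add: "p \<in> two_sided_ideal G \<Longrightarrow> q \<in> two_sided_ideal G \<Longrightarrow> p + q \<in> two_sided_ideal G"

definition relators :: "(word \<Rightarrow>\<^sub>0 'k::field) set" where
  "relators =
    {var Ga ^ 2 - 1, var Gb ^ 6 - 1, var Gx ^ 2,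
     var Ga * var Gb - var Gb * var Ga,
     var Ga * var Gx - var Gx * var Ga,
     var Gb * var Gx + var Gx * var Gb}"

abbreviation rel_ideal :: "(word \<Rightarrow>\<^sub>0 'k::field) set" where
  "rel_ideal \<equiv> two_sided_ideal relators"

lemma two_sided_ideal_uminus:
  "p \<in> two_sided_ideal G \<Longrightarrow> - p \<in> two_sided_ideal G"
proof (induction rule: two_sided_ideal.induct)
  case (gen g u v)
  then show ?case using two_sided_ideal.gen[of g G "- u" v] by simp
next
  case (add p q)
  then show ?case using two_sided_ideal.add[of "- p" G "- q"] by simp
qed (simp add: two_sided_ideal.zero)

lemma two_sided_ideal_diff:
  "p \<in> two_sided_ideal G \<Longrightarrow> q \<in> two_sided_ideal G \<Longrightarrow> p - q \<in> two_sided_ideal G"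
  using two_sided_ideal.add[of p G "- q"] two_sided_ideal_uminus[of q G] by simp

lemma two_sided_ideal_mult:
  "p \<in> two_sided_ideal G \<Longrightarrow> y * p * z \<in> two_sided_ideal G"
proof (induction rule: two_sided_ideal.induct)
  case (gen g u v)
  then show ?case using two_sided_ideal.gen[of g G "y * u" "v * z"] by (simp add: mult.assoc)
next
  case (add p q)
  then show ?case by (simp add: distrib_left distrib_right two_sided_ideal.add)
qed (simp add: two_sided_ideal.zero)

lemma free_alg_induct [case_names single add]:
  fixes p :: "word \<Rightarrow>\<^sub>0 'k::field"
  assumes single: "\<And>w r. P (scal r * wmon w)"
    and add: "\<And>p q. P p \<Longrightarrow> P q \<Longrightarrow> P (p + q)"
  shows "P p"
proof (induction p rule: Poly_Mapping.update_induct)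
  case const
  show ?case using single[of 0 undefined] by (simp add: scal_def)
next
  case (update f w r)
  have "Poly_Mapping.update w r f = f + scal r * wmon w"
  proof (rule poly_mapping_eqI)
    fix k
    show "Poly_Mapping.lookup (Poly_Mapping.update w r f) k = Poly_Mapping.lookup (f + scal r * wmon w) k"
      using update.hyps
      by (cases "w = k") (simp_all add: lookup_update scal_def wmon_def mult_single lookup_add lookup_single
          in_keys_iff when_def)
  qed
  then show ?case using add[OF update.IH single] by simp
qed

definition lin_ext :: "('k::field \<Rightarrow> 'v::ab_group_add \<Rightarrow> 'v) \<Rightarrow> (word \<Rightarrow> 'v) \<Rightarrow> (word \<Rightarrow>\<^sub>0 'k) \<Rightarrow> 'v" where
  "lin_ext sc h p = (\<Sum>w\<in>Poly_Mapping.keys p. sc (Poly_Mapping.lookup p w) (h w))"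

context vector_space
begin

lemma lin_ext_add: "lin_ext scale h (p + q) = lin_ext scale h p + lin_ext scale h q"
  unfolding lin_ext_def
  by (rule setsum_keys_plus_distrib) (simp_all add: scale_left_distrib)

lemma lin_ext_term: "lin_ext scale h (scal r * wmon w) = scale r (h w)"
  by (simp add: lin_ext_def scal_def wmon_def mult_single)

lemma lin_ext_zero: "lin_ext scale h 0 = 0"
  by (simp add: lin_ext_def)

lemma lin_ext_const: "lin_ext scale h (scal r * p) = scale r (lin_ext scale h p)"
proof (induction p rule: free_alg_induct)
  case (single w s)
  have "scal r * (scal s * wmon w) = scal (r * s) * wmon w"
    by (simp add: scal_def wmon_def mult_single)
  then show ?case by (simp add: lin_ext_term)
qed (simp add: distrib_left lin_ext_add scale_right_distrib)

lemma lin_ext_uminus: "lin_ext scale h (- p) = - lin_ext scale h p"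
  using lin_ext_add[of h p "- p"] by (simp add: lin_ext_zero eq_neg_iff_add_eq_0 add.commute)

lemma lin_ext_wmon: "lin_ext scale h (wmon w) = h w"
  using lin_ext_term[of h 1 w] by (simp add: scal_def wmon_def mult_single)

lemma lin_ext_kills_ideal:
  assumes "\<And>g u v. g \<in> relators \<Longrightarrow> lin_ext scale h (wmon u * g * wmon v) = 0"
    and "p \<in> rel_ideal"
  shows "lin_ext scale h p = 0"
  using assms(2)
proof (induction rule: two_sided_ideal.induct)
  case zero
  show ?case by (rule lin_ext_zero)
next
  case (gen g p q)
  have comm: "y * scal r = scal r * y" for y :: "word \<Rightarrow>\<^sub>0 'a" and r
    by (induction y rule: free_alg_induct)
      (simp_all add: scal_def wmon_def mult_single mult.commute distrib_left distrib_right)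
  show ?case
  proof (induction p rule: free_alg_induct)
    case (single u r)
    show ?case
    proof (induction q rule: free_alg_induct)
      case (single v s)
      have "scal r * wmon u * g * (scal s * wmon v) = scal r * (scal s * (wmon u * g * wmon v))"
        by (metis comm mult.assoc)
      then show ?case by (simp add: lin_ext_const assms(1) gen)
    qed (simp add: distrib_left lin_ext_add)
  qed (simp add: distrib_right lin_ext_add)
next
  case (add p q)
  then show ?case by (simp add: lin_ext_add)
qed

end

lemma wmon_mult: "wmon v * wmon w = (wmon (v + w) :: word \<Rightarrow>\<^sub>0 'k::field)"
  by (simp add: wmon_def mult_single)

lemma wmon_0: "wmon 0 = (1 :: word \<Rightarrow>\<^sub>0 'k::field)"
  by (simp add: wmon_def)

lemma var_power: "var g ^ n = (wmon (Word (replicate n g)) :: word \<Rightarrow>\<^sub>0 'k::field)"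
proof (induction n)
  case 0
  show ?case by (simp add: wmon_0[symmetric] zero_word_def)
qed (simp add: var_def wmon_mult plus_word_def)

interpretation k: vector_space "(*) :: 'k::field \<Rightarrow> 'k \<Rightarrow> 'k"
  by standard (simp_all add: algebra_simps)

text \<open>
  Coefficient of \<open>x\<^sup>m a\<^sup>i b\<^sup>j\<close> in a word brought to normal form; moving the \<open>x\<close> to the front
  contributes a sign for each \<open>b\<close> passed.
\<close>

definition cnt :: "gen \<Rightarrow> word \<Rightarrow> nat" where
  "cnt g w = count_list (letters w) g"

fun inv_bx :: "gen list \<Rightarrow> nat" where
  "inv_bx [] = 0"
| "inv_bx (g # w) = (if g = Gb then count_list w Gx else 0) + inv_bx w"

lemma inv_bx_append: "inv_bx (v @ w) = inv_bx v + inv_bx w + count_list v Gb * count_list w Gx"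
  by (induction v) auto

definition nf_coeff :: "nat \<Rightarrow> nat \<Rightarrow> nat \<Rightarrow> word \<Rightarrow> 'k::field" where
  "nf_coeff m i j w =
    (if cnt Gx w = m \<and> cnt Ga w mod 2 = i \<and> cnt Gb w mod 6 = j
     then (- 1) ^ inv_bx (letters w) else 0)"

lemma nf_coeff_relators:
  assumes "g \<in> relators" and "m \<le> 1"
  shows "lin_ext (*) (nf_coeff m i j) (wmon u * g * wmon v) = (0 :: 'k::field)"
proof -
  let ?n = "nf_coeff m i j :: word \<Rightarrow> 'k"
  let ?W = "\<lambda>l. u + Word l + v"
  have cong: "?n w = ?n w'"
    if "cnt Gx w = cnt Gx w'" "cnt Ga w mod 2 = cnt Ga w' mod 2" "cnt Gb w mod 6 = cnt Gb w' mod 6"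
      "even (inv_bx (letters w)) = even (inv_bx (letters w'))" for w w'
    using that by (simp add: nf_coeff_def minus_one_power_iff)
  note cnts = cnt_def plus_word_def inv_bx_append
  have aa: "?n (?W [Ga, Ga]) = ?n (?W [])"
    by (rule cong) (simp_all add: cnts)
  have bb: "?n (?W [Gb, Gb, Gb, Gb, Gb, Gb]) = ?n (?W [])"
    by (rule cong) (auto simp: cnts)
  have xx: "?n (?W [Gx, Gx]) = 0"
    using assms(2) by (simp add: cnts nf_coeff_def)
  have ab: "?n (?W [Ga, Gb]) = ?n (?W [Gb, Ga])"
    by (rule cong) (simp_all add: cnts)
  have ax: "?n (?W [Ga, Gx]) = ?n (?W [Gx, Ga])"
    by (rule cong) (simp_all add: cnts)
  have bx: "?n (?W [Gb, Gx]) = - ?n (?W [Gx, Gb])"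
    by (simp add: cnts nf_coeff_def minus_one_power_iff)
  have E: "lin_ext (*) ?n (wmon u * wmon (Word l) * wmon v) = ?n (?W l)" for l
    by (simp add: wmon_mult k.lin_ext_wmon)
  have D: "lin_ext (*) ?n (p - q) = lin_ext (*) ?n p - lin_ext (*) ?n q" for p q
    using k.lin_ext_add[of ?n p "- q"] k.lin_ext_uminus[of ?n q] by simp
  have one: "(1 :: word \<Rightarrow>\<^sub>0 'k) = wmon (Word [])"
    by (simp add: wmon_0[symmetric] zero_word_def)
  have words: "var Ga ^ 2 = (wmon (Word [Ga, Ga]) :: word \<Rightarrow>\<^sub>0 'k)"
      "var Gb ^ 6 = (wmon (Word [Gb, Gb, Gb, Gb, Gb, Gb]) :: word \<Rightarrow>\<^sub>0 'k)"
      "var Gx ^ 2 = (wmon (Word [Gx, Gx]) :: word \<Rightarrow>\<^sub>0 'k)"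
      "var g * var h = (wmon (Word [g, h]) :: word \<Rightarrow>\<^sub>0 'k)" for g h
    unfolding var_power
    by (simp_all add: var_def wmon_mult plus_word_def numeral_eq_Suc)
  from assms(1) consider
      "g = wmon (Word [Ga, Ga]) - wmon (Word [])"
    | "g = wmon (Word [Gb, Gb, Gb, Gb, Gb, Gb]) - wmon (Word [])"
    | "g = wmon (Word [Gx, Gx])"
    | "g = wmon (Word [Ga, Gb]) - wmon (Word [Gb, Ga])"
    | "g = wmon (Word [Ga, Gx]) - wmon (Word [Gx, Ga])"
    | "g = wmon (Word [Gb, Gx]) + wmon (Word [Gx, Gb])"
    unfolding relators_def words one by blast
  then show ?thesis
    by cases
      (simp_all only: right_diff_distrib left_diff_distrib distrib_left distrib_right
        D E k.lin_ext_add aa bb xx ab ax bx diff_self add.left_inverse)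
qed

lemma one_notin_rel_ideal: "(1 :: word \<Rightarrow>\<^sub>0 'k::field) \<notin> rel_ideal"
proof
  assume "(1 :: word \<Rightarrow>\<^sub>0 'k) \<in> rel_ideal"
  then have "lin_ext (*) (nf_coeff 0 0 0) (1 :: word \<Rightarrow>\<^sub>0 'k) = 0"
    using k.lin_ext_kills_ideal nf_coeff_relators by (metis zero_le_one)
  then show False
    unfolding wmon_0[symmetric] k.lin_ext_wmon
    by (simp add: nf_coeff_def cnt_def zero_word_def)
qed


section \<open>The algebra presented by the relations\<close>

quotient_type (overloaded) 'k halg = "word \<Rightarrow>\<^sub>0 'k::field" / "\<lambda>p q. p - q \<in> rel_ideal"
proof (rule equivpI)
  show "reflp (\<lambda>p q :: word \<Rightarrow>\<^sub>0 'k. p - q \<in> rel_ideal)"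
    by (simp add: reflp_def two_sided_ideal.zero)
  show "symp (\<lambda>p q :: word \<Rightarrow>\<^sub>0 'k. p - q \<in> rel_ideal)"
    using two_sided_ideal_uminus[of "p - q" for p q :: "word \<Rightarrow>\<^sub>0 'k"] by (force simp: symp_def)
  show "transp (\<lambda>p q :: word \<Rightarrow>\<^sub>0 'k. p - q \<in> rel_ideal)"
  proof (rule transpI)
    fix p q r :: "word \<Rightarrow>\<^sub>0 'k"
    assume "p - q \<in> rel_ideal" "q - r \<in> rel_ideal"
    then have "(p - q) + (q - r) \<in> rel_ideal"
      by (rule two_sided_ideal.add)
    then show "p - r \<in> rel_ideal"
      by simp
  qed
qed

instantiation halg :: (field) ring_1
begin

lift_definition zero_halg :: "'a halg" is 0 .

lift_definition one_halg :: "'a halg" is 1 .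

lift_definition plus_halg :: "'a halg \<Rightarrow> 'a halg \<Rightarrow> 'a halg" is "(+)"
  unfolding add_diff_add by (rule two_sided_ideal.add)

lift_definition uminus_halg :: "'a halg \<Rightarrow> 'a halg" is uminus
proof -
  fix p q :: "word \<Rightarrow>\<^sub>0 'a"
  assume "p - q \<in> rel_ideal"
  then have "- (p - q) \<in> rel_ideal"
    by (rule two_sided_ideal_uminus)
  then show "- p - - q \<in> rel_ideal"
    by simp
qed

lift_definition minus_halg :: "'a halg \<Rightarrow> 'a halg \<Rightarrow> 'a halg" is "(-)"
proof -
  fix p p' q q' :: "word \<Rightarrow>\<^sub>0 'a"
  assume "p - p' \<in> rel_ideal" "q - q' \<in> rel_ideal"
  then have "(p - p') - (q - q') \<in> rel_ideal"
    by (rule two_sided_ideal_diff)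
  then show "p - q - (p' - q') \<in> rel_ideal"
    by (simp add: algebra_simps)
qed

lift_definition times_halg :: "'a halg \<Rightarrow> 'a halg \<Rightarrow> 'a halg" is "(*)"
proof -
  fix p p' q q' :: "word \<Rightarrow>\<^sub>0 'a"
  assume "p - p' \<in> rel_ideal" "q - q' \<in> rel_ideal"
  then have "1 * (p - p') * q + p' * (q - q') * 1 \<in> rel_ideal"
    by (intro two_sided_ideal.add two_sided_ideal_mult)
  then show "p * q - p' * q' \<in> rel_ideal"
    by (simp add: algebra_simps)
qed

instance
proof
  fix y z w :: "'a halg"
  show "y + z + w = y + (z + w)" by transfer (simp add: two_sided_ideal.zero add.assoc)
  show "y + z = z + y" by transfer (simp add: two_sided_ideal.zero add.commute)
  show "0 + y = y" by transfer (simp add: two_sided_ideal.zero)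
  show "- y + y = 0" by transfer (simp add: two_sided_ideal.zero)
  show "y - z = y + - z" by transfer (simp add: two_sided_ideal.zero)
  show "y * z * w = y * (z * w)" by transfer (simp add: two_sided_ideal.zero mult.assoc)
  show "1 * y = y" by transfer (simp add: two_sided_ideal.zero)
  show "y * 1 = y" by transfer (simp add: two_sided_ideal.zero)
  show "(y + z) * w = y * w + z * w" by transfer (simp add: two_sided_ideal.zero distrib_right)
  show "y * (z + w) = y * z + y * w" by transfer (simp add: two_sided_ideal.zero distrib_left)
  show "(0 :: 'a halg) \<noteq> 1"
    by transfer (use one_notin_rel_ideal two_sided_ideal_uminus in force)
qed

end

lift_definition scale :: "'k::field \<Rightarrow> 'k halg \<Rightarrow> 'k halg" (infixr \<open>*\<^sub>A\<close> 75)
  is "\<lambda>r p. scal r * p"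
proof -
  fix r :: 'k and p q :: "word \<Rightarrow>\<^sub>0 'k"
  assume "p - q \<in> rel_ideal"
  then have "scal r * (p - q) * 1 \<in> rel_ideal"
    by (rule two_sided_ideal_mult)
  then show "scal r * p - scal r * q \<in> rel_ideal"
    by (simp add: right_diff_distrib)
qed

lemma scal_simps:
  "scal (r + s) = scal r + scal s" "scal r * scal s = scal (r * s)" "scal 1 = 1"
  by (simp_all add: scal_def single_add mult_single)

lemma scal_commute: "scal r * p = p * scal r"
  by (induction p rule: free_alg_induct)
    (simp_all add: scal_def wmon_def mult_single mult.commute distrib_left distrib_right)

global_interpretation A: vector_space "scale :: 'k::field \<Rightarrow> 'k halg \<Rightarrow> 'k halg"
proof
  fix r s :: 'k and y z :: "'k halg"
  show "r *\<^sub>A (y + z) = r *\<^sub>A y + r *\<^sub>A z"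
    by transfer (simp add: two_sided_ideal.zero distrib_left)
  show "(r + s) *\<^sub>A y = r *\<^sub>A y + s *\<^sub>A y"
    by transfer (simp add: two_sided_ideal.zero distrib_right scal_simps)
  show "r *\<^sub>A s *\<^sub>A y = (r * s) *\<^sub>A y"
    by transfer (simp add: two_sided_ideal.zero mult.assoc[symmetric] scal_simps)
  show "1 *\<^sub>A y = y"
    by transfer (simp add: two_sided_ideal.zero scal_simps)
qed

lemma scale_mult_left: "(r *\<^sub>A y) * z = r *\<^sub>A (y * z)"
  by transfer (simp add: two_sided_ideal.zero mult.assoc)

lemma scale_mult_right: "y * (r *\<^sub>A z) = r *\<^sub>A (y * z)"
proof transfer
  fix r :: 'a and p q :: "word \<Rightarrow>\<^sub>0 'a"
  have "p * (scal r * q) = scal r * (p * q)"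
    using scal_commute[of r p] by (simp add: mult.assoc[symmetric])
  then show "p * (scal r * q) - scal r * (p * q) \<in> rel_ideal"
    by (simp add: two_sided_ideal.zero)
qed

lift_definition gen_a :: "'k::field halg" is "var Ga" .
lift_definition gen_b :: "'k::field halg" is "var Gb" .
lift_definition gen_x :: "'k::field halg" is "var Gx" .

lift_definition wd :: "word \<Rightarrow> 'k::field halg" is wmon .

lemma wd_mult: "wd v * wd w = wd (v + w)"
  by transfer (simp add: two_sided_ideal.zero wmon_mult)

lemma wd_0: "wd 0 = 1"
  by transfer (simp add: two_sided_ideal.zero wmon_0)

lemma wd_gen: "gen_a = wd (Word [Ga])" "gen_b = wd (Word [Gb])" "gen_x = wd (Word [Gx])"
  by (transfer, simp add: two_sided_ideal.zero var_def)+

lemma halg_relations: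
  "gen_a ^ 2 = (1 :: 'k::field halg)" "gen_b ^ 6 = (1 :: 'k halg)" "gen_x ^ 2 = (0 :: 'k halg)"
  "gen_a * gen_b = (gen_b * gen_a :: 'k halg)" "gen_a * gen_x = (gen_x * gen_a :: 'k halg)"
  "gen_b * gen_x = - (gen_x * gen_b :: 'k halg)"
proof -
  have rel: "g \<in> rel_ideal" if "g \<in> relators" for g :: "word \<Rightarrow>\<^sub>0 'k"
    using two_sided_ideal.gen[OF that, of 1 1] by simp
  show "gen_a ^ 2 = (1 :: 'k halg)"
    unfolding power2_eq_square by transfer (rule rel, simp add: relators_def power2_eq_square)
  have p6: "y ^ 6 = y * y * y * y * y * y" for y :: "'z::monoid_mult"
    by (simp add: numeral_eq_Suc mult.assoc)
  show "gen_b ^ 6 = (1 :: 'k halg)"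
    unfolding p6 by transfer (rule rel, simp add: relators_def p6)
  show "gen_x ^ 2 = (0 :: 'k halg)"
    unfolding power2_eq_square by transfer (use rel in \<open>simp add: relators_def power2_eq_square\<close>)
  show "gen_a * gen_b = (gen_b * gen_a :: 'k halg)"
    by transfer (rule rel, simp add: relators_def)
  show "gen_a * gen_x = (gen_x * gen_a :: 'k halg)"
    by transfer (rule rel, simp add: relators_def)
  show "gen_b * gen_x = - (gen_x * gen_b :: 'k halg)"
    by transfer (use rel in \<open>simp add: relators_def\<close>)
qed

lemma halg_induct [case_names single add]:
  fixes y :: "'k::field halg"
  assumes "\<And>w r. P (r *\<^sub>A wd w)" and "\<And>y z. P y \<Longrightarrow> P z \<Longrightarrow> P (y + z)"
  shows "P y"
proof -
  have "P (abs_halg p)" for p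
  proof (induction p rule: free_alg_induct)
    case (single w r)
    then show ?case using assms(1)[of r w] by (simp add: scale.abs_eq wd.abs_eq)
  next
    case (add p q)
    then show ?case using assms(2) by (simp add: plus_halg.abs_eq[symmetric])
  qed
  then show ?thesis by (induction y rule: halg.abs_induct)
qed

lemma linear_extension:
  assumes "vector_space sc"
    and "\<And>g u v. g \<in> relators \<Longrightarrow> lin_ext sc h (wmon u * g * wmon v) = 0"
  obtains L :: "'k::field halg \<Rightarrow> 'v::ab_group_add"
  where "Vector_Spaces.linear scale sc L" "\<And>w. L (wd w) = h w"
proof -
  interpret V: vector_space sc by fact
  define L where "L y = lin_ext sc h (rep_halg y)" for y
  have eq: "lin_ext sc h p = lin_ext sc h q" if "p - q \<in> rel_ideal" for p q
  proof -
    have "lin_ext sc h (p - q) = 0"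
      using V.lin_ext_kills_ideal[OF assms(2) that] by blast
    then show ?thesis using V.lin_ext_add[of h "p - q" q] by simp
  qed
  have L: "L (abs_halg p) = lin_ext sc h p" for p
    unfolding L_def
    by (rule eq, rule Quotient3_rep_abs[OF Quotient3_halg]) (simp add: two_sided_ideal.zero)
  have "L (y + z) = L y + L z" for y z
    by (induction y rule: halg.abs_induct, induction z rule: halg.abs_induct)
      (simp add: L plus_halg.abs_eq V.lin_ext_add)
  moreover have "L (r *\<^sub>A y) = sc r (L y)" for r y
    by (induction y rule: halg.abs_induct) (simp add: L scale.abs_eq V.lin_ext_const)
  ultimately have "Vector_Spaces.linear scale sc L"
    by unfold_locales
  moreover have "L (wd w) = h w" for w
    by (simp add: wd.abs_eq L V.lin_ext_wmon)
  ultimately show ?thesis using that by blast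
qed


subsection \<open>The basis\<close>

definition std :: "nat \<times> nat \<times> nat \<Rightarrow> 'k::field halg" where
  "std = (\<lambda>(m, i, j). gen_x ^ m * gen_a ^ i * gen_b ^ j)"

lemma wd_gen_power:
  "gen_a ^ n = wd (Word (replicate n Ga))" "gen_b ^ n = wd (Word (replicate n Gb))"
  "gen_x ^ n = wd (Word (replicate n Gx))"
  by (induction n; simp add: wd_0[symmetric] zero_word_def wd_gen wd_mult plus_word_def)+

lemma std_wd:
  "std (m, i, j) = wd (Word (replicate m Gx @ replicate i Ga @ replicate j Gb))"
  by (simp add: std_def wd_gen_power wd_mult plus_word_def)

lemma inv_bx_std: "inv_bx (replicate m Gx @ replicate i Ga @ replicate j Gb) = 0"
proof -
  have "inv_bx (replicate n g) = 0" for n g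
    by (induction n) (auto simp: count_list_0_iff)
  then show ?thesis by (auto simp: inv_bx_append count_list_0_iff)
qed

lemma count_list_replicate: "count_list (replicate n g) h = (if g = h then n else 0)"
  by (induction n) auto

definition std_index :: "(nat \<times> nat \<times> nat) set" where
  "std_index = {..1} \<times> {..1} \<times> {..5}"

lemma coeff_functional:
  assumes "p \<in> std_index"
  shows "\<exists>L :: 'k::field halg \<Rightarrow> 'k. Vector_Spaces.linear scale (*) L \<and>
    (\<forall>q\<in>std_index. L (std q) = (if q = p then 1 else 0))"
proof -
  obtain m i j where p: "p = (m, i, j)" by (cases p)
  with assms have bounds: "m \<le> 1" "i \<le> 1" "j \<le> 5" by (auto simp: std_index_def)
  have "lin_ext (*) (nf_coeff m i j) (wmon u * g * wmon v) = (0 :: 'k)" if "g \<in> relators" for g u v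
    using nf_coeff_relators[OF that bounds(1)] .
  then obtain L :: "'k halg \<Rightarrow> 'k" where L: "Vector_Spaces.linear scale (*) L"
    "\<And>w. L (wd w) = nf_coeff m i j w"
    using linear_extension[OF k.vector_space_axioms, of "nf_coeff m i j"] by blast
  have "L (std q) = (if q = p then 1 else 0)" if "q \<in> std_index" for q
    using that bounds p
    by (auto simp: std_index_def std_wd L(2) nf_coeff_def cnt_def inv_bx_std count_list_replicate
        split: if_splits)
  with L(1) show ?thesis by blast
qed

lemma std_in_span: "std (m, i, j) \<in> A.span (std ` std_index :: 'k::field halg set)"
proof (cases "m \<le> 1")
  case True
  have "gen_a ^ i = (gen_a ^ (i mod 2) :: 'k halg)"
    using halg_relations(1) by (metis (no_types) mult_div_mod_eq power_add power_mult power_one mult_1)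
  moreover have "gen_b ^ j = (gen_b ^ (j mod 6) :: 'k halg)"
    using halg_relations(2) by (metis (no_types) mult_div_mod_eq power_add power_mult power_one mult_1)
  ultimately have "std (m, i, j) = (std (m, i mod 2, j mod 6) :: 'k halg)"
    by (simp add: std_def)
  moreover have "(m, i mod 2, j mod 6) \<in> std_index"
    using True by (auto simp: std_index_def)
  ultimately show ?thesis by (metis A.span_base image_eqI)
next
  case False
  then have "gen_x ^ m = (gen_x ^ 2 * gen_x ^ (m - 2) :: 'k halg)"
    by (metis le_add_diff_inverse not_less_eq_eq one_add_one plus_1_eq_Suc power_add)
  then show ?thesis by (simp add: std_def halg_relations A.span_zero)
qed

lemma gen_mult_std:
  "gen_a * std (m, i, j) = (std (m, Suc i, j) :: 'k::field halg)"
  "gen_b * std (m, i, j) = (- 1) ^ m * (std (m, i, Suc j) :: 'k halg)"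
  "gen_x * std (m, i, j) = (std (Suc m, i, j) :: 'k halg)"
proof -
  have ax: "gen_a * gen_x ^ m = (gen_x ^ m * gen_a :: 'k halg)"
    by (induction m) (simp_all add: mult.assoc[symmetric] halg_relations(5), simp add: mult.assoc)
  have ba: "gen_b * gen_a ^ i = (gen_a ^ i * gen_b :: 'k halg)"
    by (induction i) (simp_all add: mult.assoc[symmetric] halg_relations(4)[symmetric],
        simp add: mult.assoc)
  have bx: "gen_b * gen_x ^ m = ((- 1) ^ m * gen_x ^ m * gen_b :: 'k halg)"
  proof (induction m)
    case (Suc m)
    have "gen_b * gen_x ^ Suc m = (- (gen_x * (gen_b * gen_x ^ m)) :: 'k halg)"
      by (simp add: mult.assoc[symmetric] halg_relations(6))
    also have "\<dots> = (- 1) ^ Suc m * gen_x ^ Suc m * gen_b"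
      by (cases "even m") (simp_all add: Suc.IH mult.assoc)
    finally show ?case .
  qed simp
  show "gen_a * std (m, i, j) = (std (m, Suc i, j) :: 'k halg)"
    by (simp add: std_def mult.assoc[symmetric] ax)
  have "gen_b * std (m, i, j) = ((- 1) ^ m * gen_x ^ m * (gen_b * gen_a ^ i) * gen_b ^ j :: 'k halg)"
    by (simp add: std_def mult.assoc[symmetric] bx)
  then show "gen_b * std (m, i, j) = (- 1) ^ m * (std (m, i, Suc j) :: 'k halg)"
    by (simp add: std_def ba mult.assoc)
  show "gen_x * std (m, i, j) = (std (Suc m, i, j) :: 'k halg)"
    by (simp add: std_def mult.assoc)
qed

lemma std_inj: "inj_on (std :: _ \<Rightarrow> 'k::field halg) std_index"
proof (rule inj_onI)
  fix p q assume pq: "p \<in> std_index" "q \<in> std_index" "std p = (std q :: 'k halg)"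
  obtain L :: "'k halg \<Rightarrow> 'k" where
    "\<forall>q\<in>std_index. L (std q) = (if q = p then 1 else 0)"
    using coeff_functional[OF pq(1)] by blast
  with pq show "p = q"
    by (metis zero_neq_one)
qed

theorem halg_basis:
  "inj_on (std :: _ \<Rightarrow> 'k::field halg) std_index"
  "A.independent (std ` std_index :: 'k::field halg set)"
  "A.span (std ` std_index :: 'k halg set) = UNIV"
  "A.dim (UNIV :: 'k halg set) = 24"
proof -
  let ?B = "std ` std_index :: 'k halg set"
  show "inj_on (std :: _ \<Rightarrow> 'k halg) std_index" by (rule std_inj)
  have fin: "finite std_index"
    by (simp add: std_index_def)
  show indep: "A.independent ?B"
  proof (rule A.independent_if_scalars_zero)
    show "finite ?B" using fin by simp
    fix f :: "'k halg \<Rightarrow> 'k" and y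
    assume sum0: "(\<Sum>y\<in>?B. f y *\<^sub>A y) = 0" and "y \<in> ?B"
    then obtain p where p: "p \<in> std_index" "y = std p" by blast
    obtain L :: "'k halg \<Rightarrow> 'k" where lin: "Vector_Spaces.linear scale (*) L"
      and L: "\<forall>q\<in>std_index. L (std q) = (if q = p then 1 else 0)"
      using coeff_functional[OF p(1)] by blast
    interpret L: Vector_Spaces.linear scale "(*)" L by (rule lin)
    have "(\<Sum>q\<in>std_index. f (std q) *\<^sub>A std q) = 0"
      using sum0 by (simp add: sum.reindex[OF std_inj])
    then have "(\<Sum>q\<in>std_index. f (std q) * L (std q)) = 0"
      by (metis (no_types, lifting) L.scale L.sum L.zero sum.cong)
    then have "(\<Sum>q\<in>std_index. f (std q) * (if q = p then 1 else 0)) = 0"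
      using L by simp
    then show "f y = 0"
      using p fin by (simp add: if_distrib[of "(*) _"] sum.delta cong: if_cong)
  qed
  show span: "A.span ?B = UNIV"
  proof -
    have cl: "gen_a * y \<in> A.span ?B \<and> gen_b * y \<in> A.span ?B \<and> gen_x * y \<in> A.span ?B"
      if "y \<in> A.span ?B" for y
      using that
    proof (induction rule: A.span_induct_alt)
      case base
      show ?case by (simp add: A.span_zero)
    next
      case (step c z y)
      from step(1) obtain m i j where z: "z = std (m, i, j)" by (auto simp: std_def)
      have "(- 1) ^ m * std (m, i, Suc j) \<in> A.span ?B"
        by (cases "even m") (auto simp: std_in_span A.span_neg)
      then show ?case using step
        by (simp add: z distrib_left scale_mult_right gen_mult_std std_in_span A.span_add A.span_scale)
    qed
    have wdl: "wd (Word l) \<in> A.span ?B" for l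
    proof (induction l)
      case Nil
      show ?case using std_in_span[of 0 0 0] by (simp add: std_wd)
    next
      case (Cons g l)
      have "wd (Word (g # l)) = wd (Word [g]) * (wd (Word l) :: 'k halg)"
        by (simp add: wd_mult plus_word_def)
      then show ?case using cl[OF Cons.IH] by (cases g) (simp_all add: wd_gen)
    qed
    have "y \<in> A.span ?B" for y
    proof (induction y rule: halg_induct)
      case (single w r)
      show ?case using wdl[of "letters w"] by (simp add: A.span_scale)
    qed (rule A.span_add)
    then show ?thesis by blast
  qed
  show "A.dim (UNIV :: 'k halg set) = 24"
    using A.dim_eq_card[of ?B UNIV] indep span card_image[OF std_inj[where ?'k = 'k]]
    by (simp add: std_index_def card_cartesian_product)
qed


section \<open>Antipode and integral\<close>

definition primitive_root_of_unity :: "nat \<Rightarrow> 'k::field \<Rightarrow> bool" where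
  "primitive_root_of_unity n z \<longleftrightarrow> 0 < n \<and> z ^ n = 1 \<and> (\<forall>k. 0 < k \<and> k < n \<longrightarrow> z ^ k \<noteq> 1)"

definition idem_a :: "nat \<Rightarrow> 'k::field halg" where
  "idem_a s = (if s = 0 then (1 / 2) *\<^sub>A (1 + gen_a) else (1 / 2) *\<^sub>A (1 - gen_a))"

definition idem_b :: "'k::field \<Rightarrow> int \<Rightarrow> 'k halg" where
  "idem_b z j = (1 / 6) *\<^sub>A (\<Sum>i\<le>5. (z powi (j * int i)) *\<^sub>A gen_b ^ i)"

text \<open>
  The comultiplication \<open>\<Delta>(a) = a \<otimes> a\<close>, \<open>\<Delta>(b) = b \<otimes> e\<^sub>0b + b\<^sup>-\<^sup>1 \<otimes> e\<^sub>1b\<close>,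
  \<open>\<Delta>(x) = b\<^sup>3 \<otimes> x + x \<otimes> 1\<close> and the counit \<open>a, b \<mapsto> 1\<close>, \<open>x \<mapsto> 0\<close> are not formalised.
  Their antipode is the unital algebra antihomomorphism with the values below on the generators;
  \<open>gen_b ^ 5\<close> is \<open>b\<^sup>-\<^sup>1\<close>.  The definite description is justified by \<open>is_antipode_antipode\<close>.
\<close>

definition is_antipode :: "('k::field halg \<Rightarrow> 'k halg) \<Rightarrow> bool" where
  "is_antipode S \<longleftrightarrow>
     Vector_Spaces.linear scale scale S \<and> S 1 = 1 \<and> (\<forall>y z. S (y * z) = S z * S y) \<and>
     S gen_a = gen_a \<and>
     S gen_b = idem_a 0 * gen_b ^ 5 + idem_a 1 * gen_b \<and>
     S gen_x = - (gen_b ^ 3 * gen_x)"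

definition antipode :: "'k::field halg \<Rightarrow> 'k halg" where
  "antipode = (THE S. is_antipode S)"

definition is_lambda :: "('k::field halg \<Rightarrow> 'k) \<Rightarrow> bool" where
  "is_lambda L \<longleftrightarrow> Vector_Spaces.linear scale (*) L \<and>
     (\<forall>m\<le>1. \<forall>i\<le>1. \<forall>j\<le>5.
        L (gen_x ^ m * gen_a ^ i * gen_b ^ j) = (if m = 1 \<and> i = 0 \<and> j = 3 then 1 else 0))"

definition lambda :: "'k::field halg \<Rightarrow> 'k" where
  "lambda = (THE L. is_lambda L)"

lemma is_lambda_lambda: "is_lambda (lambda :: 'k::field halg \<Rightarrow> 'k)"
proof -
  have "(1, 0, 3) \<in> std_index"
    by (simp add: std_index_def)
  then obtain L :: "'k halg \<Rightarrow> 'k" where lin: "Vector_Spaces.linear scale (*) L"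
    and L: "\<forall>q\<in>std_index. L (std q) = (if q = (1, 0, 3) then 1 else 0)"
    using coeff_functional by blast
  have "is_lambda L"
    unfolding is_lambda_def using lin L by (auto simp: std_index_def std_def)
  moreover have "L' = L" if "is_lambda L'" for L'
  proof
    fix y :: "'k halg"
    interpret VS: vector_space_pair "scale :: 'k \<Rightarrow> 'k halg \<Rightarrow> 'k halg" "(*) :: 'k \<Rightarrow> 'k \<Rightarrow> 'k"
      by unfold_locales
    have "y \<in> A.span (std ` std_index)"
      by (simp add: halg_basis(3))
    moreover have "Vector_Spaces.linear scale (*) L'"
      using that by (simp add: is_lambda_def)
    moreover have "L' z = L z" if "z \<in> std ` std_index" for z
      using that \<open>is_lambda L'\<close> \<open>is_lambda L\<close> by (auto simp: is_lambda_def std_index_def std_def)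
    ultimately show "L' y = L y"
      using VS.linear_eq_on lin by blast
  qed
  ultimately show ?thesis
    unfolding lambda_def by (rule theI)
qed

lemma idem_a_facts:
  assumes "(2 :: 'k::field) \<noteq> 0"
  shows "idem_a 0 + idem_a 1 = (1 :: 'k halg)"
    "idem_a 0 * idem_a 0 = (idem_a 0 :: 'k halg)" "idem_a 1 * idem_a 1 = (idem_a 1 :: 'k halg)"
    "idem_a 0 * idem_a 1 = (0 :: 'k halg)" "idem_a 1 * idem_a 0 = (0 :: 'k halg)"
proof -
  have half: "(1 / 2 + 1 / 2 :: 'k) = 1"
    using assms by (simp add: field_simps)
  have double: "y + y = (2 :: 'k) *\<^sub>A y" for y :: "'k halg"
    by (metis A.scale_left_distrib A.scale_one one_add_one)
  have sq: "gen_a * gen_a = (1 :: 'k halg)"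
    using halg_relations(1) by (simp add: power2_eq_square)
  have "(2 :: 'k halg) = (2 :: 'k) *\<^sub>A 1"
    using double[of 1] by simp
  then have "(1 / 2 :: 'k) *\<^sub>A (2 :: 'k halg) = (1 / 2 * 2) *\<^sub>A 1"
    by (simp only: A.scale_scale)
  then show "idem_a 0 + idem_a 1 = (1 :: 'k halg)"
    using assms by (simp add: idem_a_def A.scale_right_distrib[symmetric])
  have "(1 + gen_a) * (1 + gen_a) = (2 :: 'k) *\<^sub>A (1 + gen_a :: 'k halg)"
    using double[of "1 + gen_a"] by (simp add: algebra_simps sq)
  then show "idem_a 0 * idem_a 0 = (idem_a 0 :: 'k halg)"
    using assms by (simp add: idem_a_def scale_mult_left scale_mult_right)
  have "(1 - gen_a) * (1 - gen_a) = (2 :: 'k) *\<^sub>A (1 - gen_a :: 'k halg)"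
    using double[of "1 - gen_a"] by (simp add: algebra_simps sq)
  then show "idem_a 1 * idem_a 1 = (idem_a 1 :: 'k halg)"
    using assms by (simp add: idem_a_def scale_mult_left scale_mult_right)
  show "idem_a 0 * idem_a 1 = (0 :: 'k halg)" "idem_a 1 * idem_a 0 = (0 :: 'k halg)"
    by (simp_all add: idem_a_def scale_mult_left scale_mult_right algebra_simps sq)
qed

lemma idem_a_commute:
  "gen_a * idem_a s = (idem_a s * gen_a :: 'k::field halg)"
  "gen_b * idem_a s = (idem_a s * gen_b :: 'k halg)"
  "gen_x * idem_a s = (idem_a s * gen_x :: 'k halg)"
  by (simp_all add: idem_a_def scale_mult_left scale_mult_right distrib_left distrib_right
      right_diff_distrib left_diff_distrib halg_relations)

definition anti_word :: "(gen \<Rightarrow> 'a::monoid_mult) \<Rightarrow> word \<Rightarrow> 'a" where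
  "anti_word h w = prod_list (map h (rev (letters w)))"

lemma anti_word_add: "anti_word h (v + w) = anti_word h w * anti_word h v"
  by (simp add: anti_word_def plus_word_def)

lemma is_antipode_antipode:
  assumes two: "(2 :: 'k::field) \<noteq> 0"
  shows "is_antipode (antipode :: 'k halg \<Rightarrow> 'k halg)"
proof -
  define c where "c = (gen_b ^ 5 :: 'k halg)"
  define h :: "gen \<Rightarrow> 'k halg" where "h = (\<lambda>g. case g of Ga \<Rightarrow> gen_a
    | Gb \<Rightarrow> idem_a 0 * c + idem_a 1 * gen_b | Gx \<Rightarrow> - (gen_b ^ 3 * gen_x))"
  let ?h = "anti_word h"
  let ?l = "lin_ext scale ?h :: _ \<Rightarrow> 'k halg"
  let ?e = "idem_a 0 :: 'k halg" and ?f = "idem_a 1 :: 'k halg"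
  note idem = idem_a_facts[OF two] idem_a_facts[OF two, unfolded One_nat_def]
  have c_comm: "c * idem_a s = idem_a s * c" for s
    unfolding c_def by (rule power_commuting_commutes) (rule idem_a_commute)
  have hb: "h Gb ^ n = ?e * c ^ n + ?f * gen_b ^ n" for n
  proof (induction n)
    case (Suc n)
    have "h Gb ^ Suc n = ?e * (c * ?e) * c ^ n + ?e * (c * ?f) * gen_b ^ n
        + ?f * (gen_b * ?e) * c ^ n + ?f * (gen_b * ?f) * gen_b ^ n"
      by (simp add: Suc.IH) (simp add: h_def algebra_simps)
    also have "\<dots> = (?e * ?e) * c * c ^ n + (?e * ?f) * c * gen_b ^ n
        + (?f * ?e) * gen_b * c ^ n + (?f * ?f) * gen_b * gen_b ^ n"
      by (simp add: c_comm idem_a_commute mult.assoc)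
    finally show ?case
      by (simp only: idem mult_zero_left add_0_left add_0_right power_Suc mult.assoc)
  qed (simp add: idem)
  have c6: "c ^ 6 = 1"
    unfolding c_def power_mult[symmetric] by (metis halg_relations(2) mult.commute power_mult power_one)
  have b6: "h Gb ^ 6 = 1"
    by (simp add: hb c6 halg_relations idem)
  have xb: "gen_x * gen_b = - (gen_b * gen_x :: 'k halg)"
    by (simp add: halg_relations)
  have xbn: "gen_x * gen_b ^ n = (- 1) ^ n * gen_b ^ n * (gen_x :: 'k halg)" for n
  proof (induction n)
    case (Suc n)
    have "gen_x * gen_b ^ Suc n = - (gen_b * (gen_x * gen_b ^ n) :: 'k halg)"
      by (simp add: mult.assoc[symmetric] xb)
    also have "\<dots> = (- 1) ^ Suc n * gen_b ^ Suc n * gen_x"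
      by (cases "even n") (simp_all add: Suc.IH mult.assoc)
    finally show ?case .
  qed simp
  have bn: "gen_b ^ m * gen_b ^ n = (gen_b ^ n * gen_b ^ m :: 'k halg)" for m n
    by (simp add: power_add[symmetric] add.commute)
  have an: "gen_a * gen_b ^ n = (gen_b ^ n * gen_a :: 'k halg)" for n
    by (rule power_commuting_commutes[symmetric]) (simp add: halg_relations)
  have "gen_b ^ 3 * gen_x * (gen_b ^ 3 * gen_x) = gen_b ^ 3 * (gen_x * gen_b ^ 3) * (gen_x :: 'k halg)"
    by (simp add: mult.assoc)
  also have "\<dots> = - (gen_b ^ 3 * gen_b ^ 3 * (gen_x * gen_x))"
    by (simp add: xbn mult.assoc)
  finally have x2: "h Gx * h Gx = 0"
    using halg_relations(3)[where ?'k = 'k] by (simp add: h_def power2_eq_square)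
  have a2: "h Ga * h Ga = 1"
    using halg_relations(1)[where ?'k = 'k] by (simp add: h_def power2_eq_square)
  have ab: "h Gb * h Ga = h Ga * h Gb"
  proof -
    have "h Ga * h Gb = idem_a 0 * (gen_a * c) + idem_a 1 * (gen_a * gen_b)"
      by (simp add: h_def distrib_left mult.assoc[symmetric] idem_a_commute)
    then show ?thesis
      by (simp add: h_def c_def an distrib_right mult.assoc halg_relations)
  qed
  have ax: "h Gx * h Ga = h Ga * h Gx"
  proof -
    have "h Ga * h Gx = - (gen_b ^ 3 * (gen_a * gen_x))"
      by (simp add: h_def mult.assoc[symmetric] an)
    then show ?thesis
      by (simp add: h_def mult.assoc halg_relations)
  qed
  have xc: "gen_x * c = - (c * gen_x)"
    by (simp add: c_def xbn)
  have bx: "h Gx * h Gb = - (h Gb * h Gx)"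
  proof -
    have b3: "gen_b ^ 3 * idem_a s = (idem_a s * gen_b ^ 3 :: 'k halg)" for s
      by (rule power_commuting_commutes) (rule idem_a_commute)
    have "h Gx * h Gb = - (gen_b ^ 3 * (gen_x * ?e) * c + gen_b ^ 3 * (gen_x * ?f) * gen_b)"
      by (simp add: h_def distrib_left mult.assoc)
    also have "\<dots> = - ((gen_b ^ 3 * ?e) * (gen_x * c) + (gen_b ^ 3 * ?f) * (gen_x * gen_b))"
      by (simp add: idem_a_commute mult.assoc)
    also have "\<dots> = ?e * (gen_b ^ 3 * c) * gen_x + ?f * (gen_b ^ 3 * gen_b) * gen_x"
      by (simp add: b3 xc xb mult.assoc)
    also have "\<dots> = ?e * (c * gen_b ^ 3) * gen_x + ?f * (gen_b * gen_b ^ 3) * gen_x"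
      unfolding c_def by (simp only: bn power_commutes)
    also have "\<dots> = - (h Gb * h Gx)"
      by (simp add: h_def distrib_right mult.assoc)
    finally show ?thesis .
  qed
  have kills: "?l (wmon u * g * wmon v) = 0" if "g \<in> relators" for g u v
  proof -
    have E: "?l (wmon u * wmon (Word l) * wmon v) = ?h v * ?h (Word l) * ?h u" for l
      by (simp add: wmon_mult A.lin_ext_wmon anti_word_add mult.assoc)
    have D: "?l (p - q) = ?l p - ?l q" for p q
      using A.lin_ext_add[of ?h p "- q"] A.lin_ext_uminus[of ?h q] by simp
    have one: "(1 :: word \<Rightarrow>\<^sub>0 'k) = wmon (Word [])"
      by (simp add: wmon_0[symmetric] zero_word_def)
    have words: "var Ga ^ 2 = (wmon (Word [Ga, Ga]) :: word \<Rightarrow>\<^sub>0 'k)"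
        "var Gb ^ 6 = (wmon (Word (replicate 6 Gb)) :: word \<Rightarrow>\<^sub>0 'k)"
        "var Gx ^ 2 = (wmon (Word [Gx, Gx]) :: word \<Rightarrow>\<^sub>0 'k)"
        "var g * var k = (wmon (Word [g, k]) :: word \<Rightarrow>\<^sub>0 'k)" for g k
      unfolding var_power
      by (simp_all add: var_def wmon_mult plus_word_def numeral_eq_Suc)
    have hw: "?h (Word []) = 1" "?h (Word (replicate 6 Gb)) = h Gb ^ 6" "?h (Word [g, k]) = h k * h g" for g k
      by (simp_all add: anti_word_def)
    from that consider
        "g = wmon (Word [Ga, Ga]) - wmon (Word [])"
      | "g = wmon (Word (replicate 6 Gb)) - wmon (Word [])"
      | "g = wmon (Word [Gx, Gx])"
      | "g = wmon (Word [Ga, Gb]) - wmon (Word [Gb, Ga])"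
      | "g = wmon (Word [Ga, Gx]) - wmon (Word [Gx, Ga])"
      | "g = wmon (Word [Gb, Gx]) + wmon (Word [Gx, Gb])"
      unfolding relators_def words one by blast
    then show ?thesis
      by cases
        (simp_all only: right_diff_distrib left_diff_distrib distrib_left distrib_right
          D E A.lin_ext_add hw a2 b6 x2 ab ax bx diff_self mult_zero_left mult_zero_right
          mult_minus_left mult_minus_right add.left_inverse add.right_inverse)
  qed
  obtain S :: "'k halg \<Rightarrow> 'k halg" where lin: "Vector_Spaces.linear scale scale S"
    and S: "\<And>w. S (wd w) = ?h w"
    using linear_extension[OF A.vector_space_axioms, of ?h] kills by blast
  interpret S: Vector_Spaces.linear "scale :: 'k \<Rightarrow> 'k halg \<Rightarrow> 'k halg" scale S by (rule lin)
  have anti: "S (y * z) = S z * S y" for y z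
  proof (induction y rule: halg_induct)
    case (single v r)
    show ?case
    proof (induction z rule: halg_induct)
      case (single w s)
      show ?case
        by (simp add: scale_mult_left scale_mult_right S.scale wd_mult S anti_word_add mult.commute)
    qed (simp add: distrib_left distrib_right S.add)
  qed (simp add: distrib_left distrib_right S.add)
  have "is_antipode S"
    unfolding is_antipode_def
  proof (intro conjI allI lin anti)
    show "S 1 = 1"
      using S[of 0] by (simp add: wd_0) (simp add: anti_word_def zero_word_def)
    show "S gen_a = gen_a" "S gen_x = - (gen_b ^ 3 * gen_x)"
      "S gen_b = idem_a 0 * gen_b ^ 5 + idem_a 1 * gen_b"
      using S[of "Word [Ga]"] S[of "Word [Gb]"] S[of "Word [Gx]"]
      by (simp_all add: wd_gen[symmetric] anti_word_def h_def c_def)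
  qed
  moreover have "T = S" if T: "is_antipode T" for T
  proof
    fix y
    interpret T: Vector_Spaces.linear "scale :: 'k \<Rightarrow> 'k halg \<Rightarrow> 'k halg" scale T
      using T by (simp add: is_antipode_def)
    have w: "T (wd (Word l)) = S (wd (Word l))" for l
    proof (induction l)
      case Nil
      then show ?case
        using T \<open>is_antipode S\<close> by (simp add: zero_word_def[symmetric] wd_0 is_antipode_def)
    next
      case (Cons g l)
      have eq: "wd (Word (g # l)) = wd (Word [g]) * (wd (Word l) :: 'k halg)"
        by (simp add: wd_mult plus_word_def)
      have "T (wd (Word [g])) = S (wd (Word [g]))"
        using T \<open>is_antipode S\<close> by (cases g) (simp_all add: wd_gen[symmetric] is_antipode_def)
      moreover have "T (y * z) = T z * T y" for y z
        using T by (simp add: is_antipode_def)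
      ultimately show ?case
        unfolding eq by (simp add: anti Cons.IH)
    qed
    show "T y = S y"
    proof (induction y rule: halg_induct)
      case (single v r)
      show ?case using w[of "letters v"] by (simp add: T.scale S.scale)
    qed (simp add: T.add S.add)
  qed
  ultimately show ?thesis
    unfolding antipode_def by (rule theI)
qed

lemma antipode_of_primitive_root:
  fixes z :: "'k::field"
  assumes "primitive_root_of_unity 6 z"
  shows "is_antipode (antipode :: 'k halg \<Rightarrow> 'k halg)"
proof (rule is_antipode_antipode)
  show "(2 :: 'k) \<noteq> 0"
  proof
    assume "(2 :: 'k) = 0"
    then have "(- 1 :: 'k) = 1"
      by (metis add_eq_0_iff one_add_one)
    moreover have "(z ^ 3)\<^sup>2 = 1" "z ^ 3 \<noteq> 1"
      using assms by (simp_all add: primitive_root_of_unity_def power_mult[symmetric])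
    ultimately show False
      by (metis power2_eq_1_iff)
  qed
qed

section \<open>The bilinear form and the subspaces\<close>

definition form :: "'k::field halg \<Rightarrow> 'k halg \<Rightarrow> 'k" where
  "form y z = lambda (z * antipode y)"

definition left_perp :: "'k::field halg set \<Rightarrow> 'k halg set" where
  "left_perp W = {v. \<forall>w\<in>W. form v w = 0}"

definition right_perp :: "'k::field halg set \<Rightarrow> 'k halg set" where
  "right_perp W = {v. \<forall>w\<in>W. form w v = 0}"

definition subalgebra :: "'k::field halg set \<Rightarrow> bool" where
  "subalgebra B \<longleftrightarrow> A.subspace B \<and> 1 \<in> B \<and> (\<forall>y\<in>B. \<forall>z\<in>B. y * z \<in> B)"

definition algR :: "'k::field halg set" where
  "algR = \<Inter> {B. subalgebra B \<and> gen_x \<in> B}"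

definition Nsub :: "'k::field \<Rightarrow> nat \<Rightarrow> int \<Rightarrow> nat \<Rightarrow> 'k halg set" where
  "Nsub z s t m = {idem_a s * idem_b z t * gen_x ^ m * r | r. r \<in> algR}"

definition direct_sum_family :: "'k::field halg set \<Rightarrow> 'i set \<Rightarrow> ('i \<Rightarrow> 'k halg set) \<Rightarrow> bool" where
  "direct_sum_family W I U \<longleftrightarrow> finite I \<and> (\<forall>i\<in>I. A.subspace (U i)) \<and>
     W = {\<Sum>i\<in>I. u i | u. \<forall>i\<in>I. u i \<in> U i} \<and>
     (\<forall>u. (\<forall>i\<in>I. u i \<in> U i) \<and> (\<Sum>i\<in>I. u i) = 0 \<longrightarrow> (\<forall>i\<in>I. u i = 0))"

definition direct_sum :: "'k::field halg set \<Rightarrow> 'k halg set \<Rightarrow> 'k halg set \<Rightarrow> bool" where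
  "direct_sum W U V \<longleftrightarrow> A.subspace U \<and> A.subspace V \<and>
     W = {u + v | u v. u \<in> U \<and> v \<in> V} \<and> U \<inter> V = {0}"

end

theory Submission
  imports Defs
begin

text \<open>
  Write \<open>e\<^sub>s\<^sub>,\<^sub>t = e\<^sub>s f\<^sub>t\<close>.  These twelve elements are orthogonal idempotents with sum \<open>1\<close>, and
  \<open>N\<^sub>s\<^sub>,\<^sub>t\<^sub>,\<^sub>m\<close> is the whole right ideal \<open>e\<^sub>s\<^sub>,\<^sub>t x\<^sup>m A\<close>: on \<open>e\<^sub>s\<^sub>,\<^sub>t x\<^sup>m\<close> right multiplication by \<open>a\<close> and \<open>b\<close>
  is by scalars, so \<open>A\<close> may take the place of \<open>R\<close> (\<open>Nsub_eq_right_ideal\<close>).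

  Orthogonals of right ideals are annihilators.  Call \<open>h\<close> adjoint to \<open>g\<close> if
  \<open>\<langle>v, g y\<rangle> = \<langle>h v, y\<rangle>\<close> and \<open>\<langle>g y, v\<rangle> = \<langle>y, h v\<rangle>\<close> for all \<open>v\<close> and \<open>y\<close>.  As the form is
  nondegenerate (\<open>form_nondegenerate\<close>), both orthogonals of \<open>g A\<close> are then \<open>{v. h v = 0}\<close>; in
  particular they coincide.  Adjoints are found from the Nakayama automorphism \<open>\<nu>\<close>, defined by
  \<open>\<lambda>(g y) = \<lambda>(y \<nu>(g))\<close> and given by \<open>a \<mapsto> a\<close>, \<open>b \<mapsto> - b\<close>, \<open>x \<mapsto> - x\<close>: since
  \<open>\<langle>y, w\<rangle> = \<lambda>(w S(y))\<close>, the first identity needs \<open>S(h) = \<nu>(g)\<close> and the second \<open>S(g) = \<nu>(h)\<close>.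
  Both hold for \<open>g = c \<in> R\<close> with \<open>h = S(c)\<close>, and for \<open>g = e\<^sub>s\<^sub>,\<^sub>t\<close> with \<open>h = e\<^sub>s\<^sub>,\<^sub>k\<close>, where
  \<open>k = (-1)\<^sup>s\<^sup>+\<^sup>1 t + 3\<close>: the sign comes from \<open>S(e\<^sub>s\<^sub>,\<^sub>t)\<close>, and the shift by \<open>3\<close> from \<open>\<nu>(b) = - b\<close> and
  \<open>\<zeta>\<^sup>3 = - 1\<close>.

  Hence the orthogonal of \<open>N\<^sub>s\<^sub>,\<^sub>t\<^sub>,\<^sub>m\<close> is \<open>{v. x\<^sup>m e\<^sub>s\<^sub>,\<^sub>k v = 0}\<close> (\<open>perp_Nsub\<close>).  For \<open>m = 0\<close> the Peirce
  decomposition of \<open>A\<close> writes it as the sum of the \<open>e\<^sub>i\<^sub>,\<^sub>j A\<close> over all other idempotents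
  (\<open>annihilator_decomposition\<close>).  For \<open>m = 1\<close> the additional part is the annihilator of \<open>x\<close> in
  the plane \<open>e\<^sub>s\<^sub>,\<^sub>k A\<close>, which is \<open>e\<^sub>s\<^sub>,\<^sub>k x A\<close> (\<open>gen_x_annihilator_decomposition\<close>).  Finally
  \<open>v\<close> is orthogonal to \<open>c W\<close> if and only if \<open>S(c) v\<close> is orthogonal to \<open>W\<close>, which gives the formula
  for translates (\<open>perp_translate\<close>).
\<close>

section \<open>The basis of monomials\<close>

lemma monomial_induct [case_names monomial add]:
  fixes y :: "'k::field halg"
  assumes "\<And>r m i j. m \<le> 1 \<Longrightarrow> i \<le> 1 \<Longrightarrow> j \<le> 5 \<Longrightarrow> P (r *\<^sub>A (gen_x ^ m * gen_a ^ i * gen_b ^ j))"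
    and "\<And>y z. P y \<Longrightarrow> P z \<Longrightarrow> P (y + z)"
  shows "P y"
proof -
  have "y \<in> A.span (std ` std_index)"
    by (simp add: halg_basis(3))
  then show ?thesis
  proof (induction rule: A.span_induct_alt)
    case base
    show ?case using assms(1)[of 0 0 0 0] by simp
  next
    case (step r b y)
    then show ?case by (auto simp: std_def std_index_def intro!: assms)
  qed
qed

lemma power_eq_power_mod: "p ^ n = 1 \<Longrightarrow> p ^ k = p ^ (k mod n)" for p :: "'m::monoid_mult"
  by (metis mult_div_mod_eq power_add power_mult power_one mult_1)

lemma gen_b_gen_x: "gen_b ^ n * gen_x = (- 1) ^ n * (gen_x * gen_b ^ n :: 'k::field halg)"
proof (induction n)
  case (Suc n)
  have "gen_b ^ Suc n * gen_x = gen_b * (gen_b ^ n * gen_x :: 'k halg)"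
    by (simp add: mult.assoc)
  also have "\<dots> = (- 1) ^ n * (gen_b * gen_x * gen_b ^ n)"
    unfolding Suc.IH by (cases "even n") (simp_all add: mult.assoc)
  finally show ?case
    by (simp add: halg_relations mult.assoc)
qed simp

lemma gen_a_commute:
  "gen_a * gen_b ^ n = (gen_b ^ n * gen_a :: 'k::field halg)"
  "gen_a * gen_x ^ n = (gen_x ^ n * gen_a :: 'k::field halg)"
  by (rule power_commuting_commutes[symmetric], simp add: halg_relations)+

lemma gen_x_square: "gen_x * gen_x = (0 :: 'k::field halg)" "gen_x * (gen_x * y) = (0 :: 'k halg)"
  using halg_relations(3)[where ?'k = 'k] by (simp_all add: power2_eq_square mult.assoc[symmetric])

section \<open>The integral and its Nakayama automorphism\<close>

lemma lambda_linear: "Vector_Spaces.linear scale (*) (lambda :: 'k::field halg \<Rightarrow> 'k)"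
  using is_lambda_lambda[where ?'k = 'k] by (simp add: is_lambda_def)

lemma lambda_simps:
  fixes y z :: "'k::field halg" and g :: "'i \<Rightarrow> 'k halg"
  shows "lambda (y + z) = lambda y + lambda z" "lambda (r *\<^sub>A y) = r * lambda y"
  "lambda (- y) = - lambda y" "lambda (y - z) = lambda y - lambda z"
  "lambda (0 :: 'k halg) = 0" "lambda (sum g I) = (\<Sum>i\<in>I. lambda (g i))"
proof -
  interpret L: Vector_Spaces.linear "scale :: 'k \<Rightarrow> 'k halg \<Rightarrow> 'k halg" "(*)" lambda
    by (rule lambda_linear)
  show "lambda (y + z) = lambda y + lambda z" "lambda (r *\<^sub>A y) = r * lambda y"
    "lambda (- y) = - lambda y" "lambda (y - z) = lambda y - lambda z"
    "lambda (0 :: 'k halg) = 0" "lambda (sum g I) = (\<Sum>i\<in>I. lambda (g i))"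
    by (simp_all add: L.add L.scale L.neg L.diff L.zero L.sum)
qed

text \<open>
  Normalising the exponents modulo \<open>2\<close> and \<open>6\<close> makes the values of \<open>\<lambda>\<close> usable after a
  multiplication by \<open>a\<close> or \<open>b\<close>, which may lead out of the basis.
\<close>

lemma lambda_monomial:
  assumes "m \<le> 1"
  shows "lambda (gen_x ^ m * gen_a ^ i * gen_b ^ j :: 'k::field halg)
    = (if m = 1 \<and> even i \<and> j mod 6 = 3 then 1 else 0)"
proof -
  have "gen_a ^ i = (gen_a ^ (i mod 2) :: 'k halg)" "gen_b ^ j = (gen_b ^ (j mod 6) :: 'k halg)"
    by (rule power_eq_power_mod, rule halg_relations)+
  moreover have "i mod 2 \<le> 1" "j mod 6 \<le> 5"
    by auto
  ultimately show ?thesis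
    using is_lambda_lambda[where ?'k = 'k] assms unfolding is_lambda_def
    by (simp add: even_iff_mod_2_eq_zero)
qed

text \<open>
  The relation says that \<open>k\<close> is the image of \<open>g\<close> under the Nakayama automorphism.  As a relation it
  can be computed from the generators by closure under sums and products, without a construction
  of the automorphism itself.
\<close>

definition nakayama :: "'k::field halg \<Rightarrow> 'k halg \<Rightarrow> bool" where
  "nakayama g k \<longleftrightarrow> (\<forall>y. lambda (g * y) = lambda (y * k))"

lemma nakayama_one: "nakayama 1 1"
  by (simp add: nakayama_def)

lemma nakayama_add: "nakayama g k \<Longrightarrow> nakayama g' k' \<Longrightarrow> nakayama (g + g') (k + k')"
  by (simp add: nakayama_def distrib_left distrib_right lambda_simps)

lemma nakayama_scale: "nakayama g k \<Longrightarrow> nakayama (r *\<^sub>A g) (r *\<^sub>A k)"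
  by (simp add: nakayama_def scale_mult_left scale_mult_right lambda_simps)

lemma nakayama_uminus: "nakayama g k \<Longrightarrow> nakayama (- g) (- k)"
  by (simp add: nakayama_def lambda_simps)

lemma nakayama_sum: "(\<And>i. i \<in> I \<Longrightarrow> nakayama (g i) (k i)) \<Longrightarrow> nakayama (sum g I) (sum k I)"
  by (simp add: nakayama_def sum_distrib_left sum_distrib_right lambda_simps)

lemma nakayama_mult: "nakayama g k \<Longrightarrow> nakayama g' k' \<Longrightarrow> nakayama (g * g') (k * k')"
  by (simp add: nakayama_def mult.assoc)

lemma nakayama_power: "nakayama g k \<Longrightarrow> nakayama (g ^ n) (k ^ n)"
  by (induction n) (simp_all add: nakayama_one nakayama_mult)

text \<open>
  Moving \<open>x\<close> past \<open>b\<^sup>j\<close> gives the sign \<open>(-1)\<^sup>j\<close>, and \<open>\<lambda>\<close> only sees monomials that contain \<open>x\<close>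
  exactly once and \<open>b\<close> with exponent \<open>3\<close> modulo \<open>6\<close>.  So the sign is \<open>- 1\<close> when \<open>x\<close> is moved
  (odd \<open>j\<close>) and when a single \<open>b\<close> is moved past the only \<open>x\<close>.
\<close>

lemma nakayama_gens:
  "nakayama gen_a (gen_a :: 'k::field halg)"
  "nakayama gen_b (- gen_b :: 'k halg)"
  "nakayama gen_x (- gen_x :: 'k halg)"
proof -
  show "nakayama gen_a (gen_a :: 'k halg)"
    unfolding nakayama_def
  proof
    fix y :: "'k halg"
    show "lambda (gen_a * y) = lambda (y * gen_a)"
    proof (induction y rule: monomial_induct)
      case (monomial r m i j)
      have "gen_a * (gen_x ^ m * gen_a ^ i * gen_b ^ j) = (gen_x ^ m * gen_a ^ i * gen_b ^ j * gen_a :: 'k halg)"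
        by (metis gen_a_commute mult.assoc power_commutes)
      then show ?case by (simp add: scale_mult_left scale_mult_right)
    qed (simp add: distrib_left distrib_right lambda_simps)
  qed
  show "nakayama gen_b (- gen_b :: 'k halg)"
    unfolding nakayama_def
  proof
    fix y :: "'k halg"
    show "lambda (gen_b * y) = lambda (y * - gen_b)"
    proof (induction y rule: monomial_induct)
      case (monomial r m i j)
      have "gen_b * (gen_x ^ m * gen_a ^ i * gen_b ^ j)
          = (- 1) ^ m * (gen_x ^ m * gen_a ^ i * gen_b ^ Suc j :: 'k halg)"
        using gen_mult_std(2)[of m i j] by (simp add: std_def)
      moreover have "gen_x ^ m * gen_a ^ i * gen_b ^ j * gen_b = (gen_x ^ m * gen_a ^ i * gen_b ^ Suc j :: 'k halg)"
        by (simp add: mult.assoc power_commutes)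
      moreover have "m = 0 \<or> m = 1" using monomial by auto
      ultimately show ?case
        by (auto simp: scale_mult_left scale_mult_right lambda_simps
            lambda_monomial[of 0, simplified] simp del: power_Suc)
    qed (simp add: distrib_left distrib_right lambda_simps)
  qed
  show "nakayama gen_x (- gen_x :: 'k halg)"
    unfolding nakayama_def
  proof
    fix y :: "'k halg"
    show "lambda (gen_x * y) = lambda (y * - gen_x)"
    proof (induction y rule: monomial_induct)
      case (monomial r m i j)
      have *: "gen_x ^ m * gen_a ^ i * gen_b ^ j * gen_x
          = (- 1) ^ j * (gen_x * (gen_x ^ m * gen_a ^ i * gen_b ^ j) :: 'k halg)"
      proof -
        have "gen_x ^ m * gen_a ^ i * gen_b ^ j * gen_x = gen_x ^ m * gen_a ^ i * (gen_b ^ j * gen_x :: 'k halg)"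
          by (simp add: mult.assoc)
        also have "\<dots> = (- 1) ^ j * (gen_x ^ m * (gen_a ^ i * gen_x) * gen_b ^ j)"
          unfolding gen_b_gen_x by (cases "even j") (simp_all add: mult.assoc)
        also have "gen_a ^ i * gen_x = (gen_x * gen_a ^ i :: 'k halg)"
          by (rule power_commuting_commutes) (rule halg_relations)
        also have "gen_x ^ m * (gen_x * gen_a ^ i) = (gen_x * (gen_x ^ m * gen_a ^ i) :: 'k halg)"
          by (simp add: mult.assoc[symmetric] power_commutes)
        finally show ?thesis by (simp add: mult.assoc)
      qed
      have "m = 0 \<or> m = 1" using monomial by auto
      then have "lambda (gen_x * (gen_x ^ m * gen_a ^ i * gen_b ^ j) :: 'k halg)
          = - lambda (gen_x ^ m * gen_a ^ i * gen_b ^ j * gen_x)"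
        unfolding * using lambda_monomial[of 1 i j, where ?'k = 'k]
        by (cases "even j") (auto simp: mult.assoc[symmetric] gen_x_square lambda_simps, presburger)
      then show ?case
        by (simp add: scale_mult_left scale_mult_right lambda_simps)
    qed (simp add: distrib_left distrib_right lambda_simps)
  qed
qed

section \<open>The idempotents\<close>

definition bi_idem :: "'k::field \<Rightarrow> nat \<Rightarrow> int \<Rightarrow> 'k halg" where
  "bi_idem z s t = idem_a s * idem_b z t"

context
  fixes z :: "'k::field"
  assumes root: "primitive_root_of_unity 6 z"
begin

lemma root_nonzero: "z \<noteq> 0" and root_six: "z ^ 6 = 1"
  using root by (auto simp: primitive_root_of_unity_def power_0_left)

lemma root_cubed: "z ^ 3 = - 1"
proof -
  have "(z ^ 3)\<^sup>2 = 1" "z ^ 3 \<noteq> 1"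
    using root by (simp_all add: primitive_root_of_unity_def power_mult[symmetric])
  then show ?thesis
    by (metis power2_eq_1_iff)
qed

text \<open>
  The denominators \<open>2\<close> and \<open>6\<close> of the idempotents are invertible because a primitive sixth root of
  unity excludes characteristic \<open>2\<close> (where \<open>\<zeta>\<^sup>3 = - 1 = 1\<close>) and characteristic \<open>3\<close> (where
  \<open>(\<zeta>\<^sup>2 - 1)\<^sup>3 = \<zeta>\<^sup>6 - 1 = 0\<close>).
\<close>

lemma two_three_nonzero: "(2 :: 'k) \<noteq> 0" "(3 :: 'k) \<noteq> 0"
proof -
  show "(2 :: 'k) \<noteq> 0"
  proof
    assume "(2 :: 'k) = 0"
    then have "(- 1 :: 'k) = 1"
      by (metis add_eq_0_iff one_add_one)
    then have "z ^ 3 = 1"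
      by (simp add: root_cubed)
    then show False
      using root by (simp add: primitive_root_of_unity_def)
  qed
  show "(3 :: 'k) \<noteq> 0"
  proof
    assume three: "(3 :: 'k) = 0"
    define w where "w = z ^ 2"
    have w: "w \<noteq> 1" "w ^ 3 = 1"
      using root by (simp_all add: w_def primitive_root_of_unity_def power_mult[symmetric])
    have "(w - 1) ^ 3 = w ^ 3 - 1 - 3 * (w * w - w)"
      by algebra
    then have "(w - 1) ^ 3 = 0"
      by (simp add: three w)
    then show False
      using w by simp
  qed
qed

lemma six_nonzero: "(6 :: 'k) \<noteq> 0"
proof -
  have "(6 :: 'k) = 2 * 3" by simp
  then show ?thesis using two_three_nonzero by (metis mult_eq_0_iff)
qed

lemma root_powi_mod: "z powi n = z powi (n mod 6)"
proof -
  have "z powi n = z powi (6 * (n div 6)) * z powi (n mod 6)"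
    using root_nonzero by (simp add: power_int_add[symmetric])
  also have "z powi (6 * (n div 6)) = 1"
    by (simp add: power_int_mult root_six)
  finally show ?thesis by simp
qed

lemma root_powi_cong: "[i = j] (mod 6) \<Longrightarrow> z powi i = z powi j"
  using root_powi_mod[of i] root_powi_mod[of j] by (simp add: cong_def)

lemma root_powi_eq_one_iff: "z powi n = 1 \<longleftrightarrow> n mod 6 = 0"
proof
  assume *: "z powi n = 1"
  define k where "k = nat (n mod 6)"
  have k: "n mod 6 = int k" "k < 6"
    unfolding k_def by auto
  have "z ^ k = 1"
    using * by (subst (asm) root_powi_mod) (simp add: k)
  then have "k = 0"
    using root k by (auto simp: primitive_root_of_unity_def)
  then show "n mod 6 = 0"
    using k by simp
qed (subst root_powi_mod, simp)

lemma root_powi_six: "(z powi j) ^ 6 = 1"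
  using root_powi_eq_one_iff[of "j * 6"] by (simp add: power_int_mult)

lemma root_powi_add_three: "z powi (j + 3) = - (z powi j)"
  using root_nonzero root_cubed by (simp add: power_int_add)

lemma geometric_sum_six:
  fixes u :: 'k
  assumes "u ^ 6 = 1"
  shows "(\<Sum>i\<le>5. u ^ i) = (if u = 1 then 6 else 0)"
proof (cases "u = 1")
  case False
  have "1 - u ^ Suc 5 = (1 - u) * (\<Sum>i\<le>5. u ^ i)"
    unfolding lessThan_Suc_atMost[symmetric] by (rule one_diff_power_eq)
  then show ?thesis using False assms by simp
qed simp

lemma idem_b_altdef: "idem_b z j = (1 / 6) *\<^sub>A (\<Sum>i\<le>5. ((z powi j) ^ i) *\<^sub>A gen_b ^ i)"
  by (simp add: idem_b_def power_int_mult)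

lemma idem_b_cong: "[i = j] (mod 6) \<Longrightarrow> idem_b z i = idem_b z j"
  unfolding idem_b_altdef by (simp only: root_powi_cong[of i j])

text \<open>
  Multiplication by \<open>q b\<close> shifts the summands cyclically because \<open>(q b)\<^sup>6 = 1\<close>; so the sum is an
  eigenvector of \<open>b\<close>.
\<close>

lemma sum_powers_shift:
  fixes q :: 'k
  assumes "q ^ 6 = 1"
  shows "gen_b * (\<Sum>i\<le>5. (q ^ i) *\<^sub>A gen_b ^ i :: 'k halg) = (1 / q) *\<^sub>A (\<Sum>i\<le>5. (q ^ i) *\<^sub>A gen_b ^ i)"
proof -
  let ?h = "\<lambda>i. (q ^ i) *\<^sub>A gen_b ^ i :: 'k halg"
  have q: "q \<noteq> 0" using assms by auto
  have "q *\<^sub>A (gen_b * (\<Sum>i\<le>5. ?h i)) = (\<Sum>i\<le>5. ?h (Suc i))"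
    by (simp add: sum_distrib_left A.scale_sum_right scale_mult_right)
  also have "\<dots> = (\<Sum>i\<le>5. ?h i) + (?h 6 - ?h 0)"
  proof -
    have "(\<Sum>i\<le>n. g (Suc i)) = (\<Sum>i\<le>n. g i) + (g (Suc n) - g 0)" for n and g :: "nat \<Rightarrow> 'k halg"
      by (induction n) simp_all
    from this[of ?h 5] show ?thesis by (simp del: power_Suc)
  qed
  also have "?h 6 = ?h 0"
    by (simp add: assms halg_relations)
  finally have "(1 / q) *\<^sub>A (q *\<^sub>A (gen_b * (\<Sum>i\<le>5. ?h i))) = (1 / q) *\<^sub>A (\<Sum>i\<le>5. ?h i)"
    by simp
  then show ?thesis using q by simp
qed

lemma gen_b_idem_b: "gen_b * idem_b z j = (1 / z powi j) *\<^sub>A idem_b z j"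
  unfolding idem_b_altdef scale_mult_right sum_powers_shift[OF root_powi_six]
  by (simp add: A.scale_left_commute mult.commute)

lemma gen_b_commute_idem_b: "gen_b ^ n * idem_b z j = idem_b z j * gen_b ^ n"
  unfolding idem_b_altdef
  by (simp add: sum_distrib_left sum_distrib_right scale_mult_left scale_mult_right
      power_add[symmetric] add.commute)

lemma gen_a_commute_idem_b: "gen_a * idem_b z j = idem_b z j * gen_a"
  unfolding idem_b_altdef
  by (simp add: sum_distrib_left sum_distrib_right scale_mult_left scale_mult_right gen_a_commute)

lemma gen_b_power_idem_b: "gen_b ^ n * idem_b z j = ((1 / z powi j) ^ n) *\<^sub>A idem_b z j"
  by (induction n) (simp_all add: mult.assoc scale_mult_right gen_b_idem_b mult.commute)

text \<open>
  \<open>b\<close> acts on \<open>f\<^sub>j\<close> by \<open>\<zeta>\<^sup>-\<^sup>j\<close>, so \<open>f\<^sub>i\<close> acts by the mean of the powers of \<open>\<zeta>\<^sup>i\<^sup>-\<^sup>j\<close>: the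
  orthogonality of the characters of the cyclic group of order \<open>6\<close>.
\<close>

lemma idem_b_mult: "idem_b z i * idem_b z j = (if [i = j] (mod 6) then idem_b z j else 0)"
proof -
  define u where "u = z powi (i - j)"
  have u: "u = z powi i * (1 / z powi j)" "u ^ 6 = 1"
    using root_nonzero root_powi_six[of "i - j"] by (simp_all add: u_def power_int_diff)
  have "idem_b z i * idem_b z j = (1 / 6) *\<^sub>A (\<Sum>n\<le>5. ((z powi i) ^ n) *\<^sub>A (gen_b ^ n * idem_b z j))"
    unfolding idem_b_altdef[of i] by (simp add: scale_mult_left sum_distrib_right)
  also have "\<dots> = (1 / 6) *\<^sub>A (\<Sum>n\<le>5. u ^ n) *\<^sub>A idem_b z j"
    unfolding gen_b_power_idem_b A.scale_scale u(1) power_mult_distrib A.scale_sum_left by simp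
  also have "\<dots> = (if u = 1 then idem_b z j else 0)"
    using six_nonzero by (simp add: geometric_sum_six[OF u(2)])
  also have "u = 1 \<longleftrightarrow> [i = j] (mod 6)"
    by (simp add: u_def root_powi_eq_one_iff cong_iff_dvd_diff dvd_eq_mod_eq_0)
  finally show ?thesis .
qed

lemma sum_idem_b: "(\<Sum>j\<in>{0..5}. idem_b z j) = (1 :: 'k halg)"
proof -
  have inner: "(\<Sum>j\<in>{0..5::int}. (z powi j) ^ i) = (if i = 0 then 6 else 0)" if "i \<le> 5" for i
  proof -
    have "{0..5::int} = int ` {..5}"
      using image_int_atLeastAtMost[of 0 5] by (simp add: atMost_atLeast0)
    then have "(\<Sum>j\<in>{0..5::int}. (z powi j) ^ i) = (\<Sum>j\<le>5. (z ^ i) ^ j)"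
      by (simp add: sum.reindex power_mult[symmetric] mult.commute)
    also have "\<dots> = (if z ^ i = 1 then 6 else 0)"
      by (rule geometric_sum_six) (simp add: power_mult[symmetric] mult.commute[of i] root_six power_mult[of z 6])
    also have "z ^ i = 1 \<longleftrightarrow> i = 0"
      using root that by (auto simp: primitive_root_of_unity_def)
    finally show ?thesis .
  qed
  have "(\<Sum>j\<in>{0..5::int}. idem_b z j)
      = (1 / 6) *\<^sub>A (\<Sum>j\<in>{0..5::int}. \<Sum>i\<le>5. ((z powi j) ^ i) *\<^sub>A gen_b ^ i)"
    unfolding idem_b_altdef A.scale_sum_right by simp
  also have "\<dots> = (1 / 6) *\<^sub>A (\<Sum>i\<le>5. (\<Sum>j\<in>{0..5::int}. (z powi j) ^ i) *\<^sub>A gen_b ^ i)"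
    by (subst sum.swap) (simp add: A.scale_sum_left)
  also have "\<dots> = (1 / 6) *\<^sub>A (\<Sum>i\<le>5. (if i = 0 then 6 else 0) *\<^sub>A gen_b ^ i)"
    using inner by (intro arg_cong[where f = "scale _"] sum.cong) auto
  also have "\<dots> = (1 / 6) *\<^sub>A 6 *\<^sub>A (1 :: 'k halg)"
    by (simp add: if_distrib[of "\<lambda>r. r *\<^sub>A _"] cong: if_cong)
  finally show ?thesis using six_nonzero by simp
qed

text \<open>
  Moving \<open>x\<close> past \<open>b\<^sup>i\<close> multiplies by \<open>(-1)\<^sup>i = \<zeta>\<^sup>3\<^sup>i\<close>, which shifts the character by \<open>3\<close>.
\<close>

lemma idem_b_gen_x: "idem_b z j * gen_x = gen_x * idem_b z (j + 3)"
proof -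
  have "idem_b z j * gen_x = (1 / 6) *\<^sub>A (\<Sum>i\<le>5. ((z powi j) ^ i) *\<^sub>A (gen_b ^ i * gen_x))"
    unfolding idem_b_altdef by (simp add: scale_mult_left sum_distrib_right)
  also have "\<dots> = (1 / 6) *\<^sub>A (\<Sum>i\<le>5. gen_x * (((z powi (j + 3)) ^ i) *\<^sub>A gen_b ^ i))"
  proof -
    have "((z powi j) ^ i) *\<^sub>A (gen_b ^ i * gen_x) = gen_x * (((z powi (j + 3)) ^ i) *\<^sub>A gen_b ^ i)" for i
      unfolding gen_b_gen_x root_powi_add_three
      by (cases "even i") (simp_all add: scale_mult_right)
    then show ?thesis by simp
  qed
  finally show ?thesis
    unfolding idem_b_altdef by (simp add: scale_mult_right sum_distrib_left)
qed

text \<open>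
  The automorphism replaces \<open>b\<close> by \<open>- b = \<zeta>\<^sup>3 b\<close>, which again shifts the character by \<open>3\<close>.
\<close>

lemma nakayama_idem_b: "nakayama (idem_b z j) (idem_b z (j + 3))"
proof -
  have "((z powi (j + 3)) ^ i) *\<^sub>A gen_b ^ i = ((z powi j) ^ i) *\<^sub>A ((- gen_b) ^ i :: 'k halg)" for i
    unfolding root_powi_add_three by (cases "even i") simp_all
  then show ?thesis
    unfolding idem_b_altdef
    by (auto intro!: nakayama_scale nakayama_sum nakayama_power nakayama_gens)
qed

lemma nakayama_idem_a: "nakayama (idem_a s) (idem_a s :: 'k halg)"
  using nakayama_scale[OF nakayama_add[OF nakayama_one nakayama_gens(1)]]
    nakayama_scale[OF nakayama_add[OF nakayama_one nakayama_uminus[OF nakayama_gens(1)]]]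
  by (auto simp: idem_a_def)


section \<open>The antipode\<close>

lemma antipode_axioms: "is_antipode (antipode :: 'k halg \<Rightarrow> 'k halg)"
  using root by (rule antipode_of_primitive_root)

lemma antipode_simps:
  fixes y w :: "'k halg"
  shows "antipode (y + w) = antipode y + antipode w" "antipode (r *\<^sub>A y) = r *\<^sub>A antipode y"
    "antipode (- y) = - antipode y" "antipode (y - w) = antipode y - antipode w"
    "antipode (sum g I) = (\<Sum>i\<in>I. antipode (g i :: 'k halg))"
    "antipode (1 :: 'k halg) = 1" "antipode (y * w) = antipode w * antipode y"
    "antipode (gen_a :: 'k halg) = gen_a" "antipode (gen_x :: 'k halg) = - (gen_b ^ 3 * gen_x)"
proof -
  interpret S: Vector_Spaces.linear "scale :: 'k \<Rightarrow> 'k halg \<Rightarrow> 'k halg" scale antipode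
    using antipode_axioms by (simp add: is_antipode_def)
  show "antipode (y + w) = antipode y + antipode w" "antipode (r *\<^sub>A y) = r *\<^sub>A antipode y"
    "antipode (- y) = - antipode y" "antipode (y - w) = antipode y - antipode w"
    "antipode (sum g I) = (\<Sum>i\<in>I. antipode (g i :: 'k halg))"
    by (simp_all add: S.add S.scale S.neg S.diff S.sum)
  show "antipode (1 :: 'k halg) = 1" "antipode (y * w) = antipode w * antipode y"
    "antipode (gen_a :: 'k halg) = gen_a" "antipode (gen_x :: 'k halg) = - (gen_b ^ 3 * gen_x)"
    using antipode_axioms by (simp_all add: is_antipode_def)
qed

lemma antipode_power: "antipode (y ^ n) = antipode (y :: 'k halg) ^ n"
  by (induction n) (simp_all add: antipode_simps power_commutes)

lemma antipode_idem_a: "antipode (idem_a s) = (idem_a s :: 'k halg)"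
  by (simp add: idem_a_def antipode_simps)

lemma gen_commute_idem_a: "gen_b ^ n * idem_a s = idem_a s * (gen_b ^ n :: 'k halg)"
  by (rule power_commuting_commutes) (rule idem_a_commute)

text \<open>
  \<open>S(b)\<close> is \<open>b\<^sup>-\<^sup>1 = b\<^sup>5\<close> on the summand \<open>e\<^sub>0 A\<close> and \<open>b\<close> on \<open>e\<^sub>1 A\<close>.
\<close>

lemma antipode_gen_b_power_idem_a:
  assumes "s \<le> 1"
  shows "antipode gen_b ^ n * idem_a s = gen_b ^ ((if s = 0 then 5 else 1) * n) * (idem_a s :: 'k halg)"
proof (induction n)
  case (Suc n)
  define k :: nat where "k = (if s = 0 then 5 else 1)"
  have s: "s = 0 \<or> s = 1"
    using assms by auto
  have base: "antipode gen_b * idem_a s = gen_b ^ k * (idem_a s :: 'k halg)"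
  proof -
    have "antipode gen_b = idem_a 0 * gen_b ^ 5 + idem_a 1 * (gen_b ^ 1 :: 'k halg)"
      using antipode_axioms by (simp add: is_antipode_def)
    also have "\<dots> = gen_b ^ 5 * idem_a 0 + gen_b ^ 1 * idem_a 1"
      by (simp only: gen_commute_idem_a)
    finally show ?thesis
      using s idem_a_facts(2-5)[OF two_three_nonzero(1)]
      by (auto simp: k_def distrib_right mult.assoc)
  qed
  have "antipode gen_b ^ Suc n * idem_a s = antipode gen_b * (gen_b ^ (k * n) * (idem_a s :: 'k halg))"
    using Suc.IH by (simp add: k_def mult.assoc)
  also have "\<dots> = antipode gen_b * idem_a s * gen_b ^ (k * n)"
    by (simp add: gen_commute_idem_a mult.assoc)
  also have "\<dots> = gen_b ^ (k * Suc n) * idem_a s"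
    by (simp add: base mult.assoc power_add gen_commute_idem_a[symmetric])
  finally show ?case by (simp add: k_def)
qed simp

lemma antipode_squared_gens:
  "antipode (antipode gen_a) = (gen_a :: 'k halg)"
  "antipode (antipode gen_b) = (gen_b :: 'k halg)"
  "antipode (antipode gen_x) = (- gen_x :: 'k halg)"
proof -
  show "antipode (antipode gen_a) = (gen_a :: 'k halg)"
    by (simp add: antipode_simps)
  have b_power: "gen_b ^ n = (gen_b ^ (n mod 6) :: 'k halg)" for n
    by (rule power_eq_power_mod) (rule halg_relations)
  have "antipode gen_b = idem_a 0 * gen_b ^ 5 + idem_a 1 * (gen_b :: 'k halg)"
    using antipode_axioms by (simp add: is_antipode_def)
  then have "antipode (antipode gen_b)
      = antipode gen_b ^ 5 * idem_a 0 + antipode gen_b ^ 1 * (idem_a 1 :: 'k halg)"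
    by (simp add: antipode_simps antipode_power antipode_idem_a)
  also have "\<dots> = gen_b ^ 25 * idem_a 0 + gen_b * idem_a 1"
    using antipode_gen_b_power_idem_a[of 0 5] antipode_gen_b_power_idem_a[of 1 1] by simp
  also have "gen_b ^ 25 = (gen_b :: 'k halg)"
    by (subst b_power) simp
  also have "gen_b * idem_a 0 + gen_b * idem_a 1 = (gen_b :: 'k halg)"
    by (simp only: distrib_left[symmetric] idem_a_facts(1)[OF two_three_nonzero(1)] mult_1_right)
  finally show "antipode (antipode gen_b) = (gen_b :: 'k halg)" .
  have b3: "antipode (gen_b ^ 3) = (gen_b ^ 3 :: 'k halg)"
  proof -
    have "antipode gen_b ^ 3 = antipode gen_b ^ 3 * idem_a 0 + antipode gen_b ^ 3 * (idem_a 1 :: 'k halg)"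
      by (simp only: distrib_left[symmetric] idem_a_facts(1)[OF two_three_nonzero(1)] mult_1_right)
    also have "\<dots> = gen_b ^ 15 * idem_a 0 + gen_b ^ 3 * idem_a 1"
      using antipode_gen_b_power_idem_a[of 0 3] antipode_gen_b_power_idem_a[of 1 3] by simp
    also have "gen_b ^ 15 = (gen_b ^ 3 :: 'k halg)"
      by (subst b_power) simp
    also have "gen_b ^ 3 * idem_a 0 + gen_b ^ 3 * idem_a 1 = (gen_b ^ 3 :: 'k halg)"
      by (simp only: distrib_left[symmetric] idem_a_facts(1)[OF two_three_nonzero(1)] mult_1_right)
    finally show ?thesis by (simp add: antipode_power)
  qed
  have "antipode (antipode gen_x) = gen_b ^ 3 * gen_x * (gen_b ^ 3 :: 'k halg)"
    by (simp add: antipode_simps b3)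
  also have "\<dots> = - gen_x * (gen_b ^ 3 * gen_b ^ 3)"
    by (simp add: gen_b_gen_x mult.assoc)
  also have "gen_b ^ 3 * gen_b ^ 3 = (1 :: 'k halg)"
    by (simp add: power_add[symmetric] halg_relations)
  finally show "antipode (antipode gen_x) = (- gen_x :: 'k halg)" by simp
qed

text \<open>
  \<open>S\<^sup>2\<close> is multiplicative, fixes \<open>a\<close> and \<open>b\<close> and sends \<open>x\<close> to \<open>- x\<close>.  The consequence used below is
  that \<open>S\<close> is bijective.
\<close>

lemma antipode_order_four: "antipode (antipode (antipode (antipode y))) = (y :: 'k halg)"
proof (induction y rule: monomial_induct)
  case (monomial r m i j)
  have "antipode (antipode (gen_x ^ m * gen_a ^ i * gen_b ^ j))
      = (- 1) ^ m * (gen_x ^ m * gen_a ^ i * gen_b ^ j :: 'k halg)"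
    by (cases "even m") (simp_all add: antipode_simps(7) antipode_power antipode_squared_gens mult.assoc)
  then show ?case
    by (cases "even m") (simp_all add: antipode_simps(2,3))
qed (simp add: antipode_simps)

text \<open>
  On \<open>e\<^sub>0 A\<close> the antipode inverts \<open>b\<close> and hence the character \<open>t\<close>; on \<open>e\<^sub>1 A\<close> it fixes both.
\<close>

lemma antipode_bi_idem:
  assumes "s \<le> 1"
  shows "antipode (bi_idem z s t) = bi_idem z s ((- 1) ^ (s + 1) * t)"
proof -
  define q where "q = z powi t"
  have q6: "q ^ 6 = 1" unfolding q_def by (rule root_powi_six)
  have q: "q \<noteq> 0" using q6 by auto
  have "antipode (bi_idem z s t) = (1 / 6) *\<^sub>A (\<Sum>i\<le>5. (q ^ i) *\<^sub>A (antipode gen_b ^ i * idem_a s))"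
    by (simp add: bi_idem_def idem_b_altdef antipode_simps(2,5,7) antipode_power antipode_idem_a
        scale_mult_left sum_distrib_right q_def)
  also have "\<dots> = (1 / 6) *\<^sub>A (\<Sum>i\<le>5. (q ^ i) *\<^sub>A gen_b ^ ((if s = 0 then 5 else 1) * i)) * idem_a s"
    unfolding antipode_gen_b_power_idem_a[OF assms]
    by (simp add: scale_mult_left sum_distrib_right)
  also have "(1 / 6) *\<^sub>A (\<Sum>i\<le>5. (q ^ i) *\<^sub>A gen_b ^ ((if s = 0 then 5 else 1) * i))
      = idem_b z ((- 1) ^ (s + 1) * t)"
  proof (cases "s = 0")
    case True
    have "(1 / q) ^ 6 = 1"
      using q6 by (simp add: power_divide)
    have involution: "5 * (5 * i mod 6) mod 6 = i" if "i \<le> 5" for i :: nat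
    proof -
      have "i \<in> {0, 1, 2, 3, 4, 5}" using that by auto
      then show ?thesis by auto
    qed
    have "(\<Sum>i\<le>5. (q ^ i) *\<^sub>A gen_b ^ (5 * i)) = (\<Sum>i\<le>5. ((1 / q) ^ i) *\<^sub>A gen_b ^ i :: 'k halg)"
    \<comment> \<open>\<open>5 = - 1\<close> modulo \<open>6\<close>: the substitution \<open>i \<mapsto> 5 i\<close> is the inversion of the exponents.\<close>
    proof (rule sum.reindex_bij_witness[of _ "\<lambda>i. 5 * i mod 6" "\<lambda>i. 5 * i mod 6"])
      fix i :: nat
      have "(1 / q) ^ 5 = q"
        using q q6 by (simp add: field_simps power_Suc[symmetric] del: power_Suc)
      then have "(1 / q) ^ (5 * i mod 6) = q ^ i"
        using power_eq_power_mod[OF \<open>(1 / q) ^ 6 = 1\<close>, of "5 * i"] by (simp only: power_mult)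
      then show "((1 / q) ^ (5 * i mod 6)) *\<^sub>A gen_b ^ (5 * i mod 6) = (q ^ i) *\<^sub>A (gen_b ^ (5 * i) :: 'k halg)"
        using power_eq_power_mod[OF halg_relations(2)[where ?'k = 'k], of "5 * i"] by simp
      show "5 * i mod 6 \<in> {..5}" "5 * i mod 6 \<in> {..5}"
        by auto
    qed (use involution in auto)
    then show ?thesis
      using True by (simp add: idem_b_altdef q_def power_int_minus_divide)
  next
    case False
    then have "s = 1" using assms by simp
    then show ?thesis by (simp add: idem_b_altdef q_def)
  qed
  also have "\<dots> * idem_a s = bi_idem z s ((- 1) ^ (s + 1) * t)"
    unfolding bi_idem_def by (simp add: idem_b_altdef scale_mult_left scale_mult_right
        sum_distrib_left sum_distrib_right gen_commute_idem_a)
  finally show ?thesis .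
qed


section \<open>Adjoints for the bilinear form\<close>

text \<open>
  One element serves both arguments of the form.  This is what makes the left and the right
  orthogonals agree.
\<close>

definition adjoint_pair :: "'k halg \<Rightarrow> 'k halg \<Rightarrow> bool" where
  "adjoint_pair g h \<longleftrightarrow>
    (\<forall>v y. form v (g * y) = form (h * v) y \<and> form (g * y) v = form y (h * v))"

text \<open>
  \<open>\<langle>v, g y\<rangle> = \<lambda>(g y S(v))\<close> and \<open>\<langle>h v, y\<rangle> = \<lambda>(y S(v) S(h))\<close>, so the first identity says that \<open>g\<close>
  can be moved to the other end as \<open>S(h)\<close>; in the second identity \<open>g\<close> and \<open>h\<close> exchange their roles.
\<close>

lemma adjoint_pairI:
  assumes "nakayama g (antipode h)" and "nakayama h (antipode g)"
  shows "adjoint_pair g h"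
  unfolding adjoint_pair_def form_def antipode_simps
  using assms by (simp add: nakayama_def mult.assoc)

lemma adjoint_pair_one: "adjoint_pair 1 1"
  by (simp add: adjoint_pair_def)

lemma adjoint_pair_add: "adjoint_pair g h \<Longrightarrow> adjoint_pair g' h' \<Longrightarrow> adjoint_pair (g + g') (h + h')"
  by (simp add: adjoint_pair_def form_def distrib_left distrib_right antipode_simps(1) lambda_simps)

lemma adjoint_pair_scale: "adjoint_pair g h \<Longrightarrow> adjoint_pair (r *\<^sub>A g) (r *\<^sub>A h)"
  by (simp add: adjoint_pair_def form_def scale_mult_left scale_mult_right antipode_simps(2) lambda_simps)

lemma adjoint_pair_mult: "adjoint_pair g h \<Longrightarrow> adjoint_pair g' h' \<Longrightarrow> adjoint_pair (g * g') (h' * h)"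
  by (simp add: adjoint_pair_def mult.assoc)

lemma adjoint_pair_power: "adjoint_pair g h \<Longrightarrow> adjoint_pair (g ^ n) (h ^ n)"
proof (induction n)
  case (Suc n)
  then show ?case
    using adjoint_pair_mult[of g h "g ^ n" "h ^ n"] by (simp add: power_commutes)
qed (simp add: adjoint_pair_one)

text \<open>
  \<open>\<nu>(x) = - x = S(S(x))\<close>, and \<open>S(x) = - b\<^sup>3 x\<close> is fixed by \<open>\<nu>\<close> because the four signs cancel.
\<close>

lemma adjoint_pair_gen_x: "adjoint_pair gen_x (antipode gen_x)"
proof (rule adjoint_pairI)
  show "nakayama gen_x (antipode (antipode (gen_x :: 'k halg)))"
    by (simp add: antipode_squared_gens nakayama_gens)
  have "nakayama (- (gen_b ^ 3 * gen_x)) (- ((- gen_b) ^ 3 * - gen_x) :: 'k halg)"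
    by (intro nakayama_uminus nakayama_mult nakayama_power nakayama_gens)
  then show "nakayama (antipode gen_x) (antipode (gen_x :: 'k halg))"
    by (simp add: antipode_simps)
qed

text \<open>
  \<open>S\<close> reverses products as passing to adjoints does, so the elements \<open>c\<close> with adjoint \<open>S(c)\<close> form a
  subalgebra, and it contains the generator \<open>x\<close> of \<open>R\<close>.
\<close>

lemma adjoint_pair_algR:
  assumes "c \<in> algR"
  shows "adjoint_pair c (antipode c)"
proof -
  have "subalgebra {c. adjoint_pair c (antipode c)}"
    unfolding subalgebra_def A.subspace_def
  proof (intro conjI ballI allI)
    have "adjoint_pair (0 *\<^sub>A 1) (0 *\<^sub>A 1)"
      by (rule adjoint_pair_scale) (rule adjoint_pair_one)
    then show "0 \<in> {c. adjoint_pair c (antipode c)}"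
      using antipode_simps(2)[of 0 1] by simp
  qed (auto simp: antipode_simps(1,2,6,7) intro: adjoint_pair_add adjoint_pair_scale
      adjoint_pair_one adjoint_pair_mult)
  then show ?thesis
    using assms adjoint_pair_gen_x unfolding algR_def by auto
qed

section \<open>The Peirce decomposition\<close>

lemma bi_idem_cong: "[i = j] (mod 6) \<Longrightarrow> bi_idem z s i = bi_idem z s j"
  unfolding bi_idem_def by (drule idem_b_cong) simp

lemma idem_a_commute_idem_b: "idem_a s * idem_b z t = idem_b z t * idem_a s"
  unfolding idem_b_altdef
  by (simp only: scale_mult_left scale_mult_right sum_distrib_left sum_distrib_right gen_commute_idem_a)

lemma bi_idem_mult:
  assumes "s \<le> 1" "s' \<le> 1"
  shows "bi_idem z s i * bi_idem z s' j = (if s = s' \<and> [i = j] (mod 6) then bi_idem z s j else 0)"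
proof -
  have "bi_idem z s i * bi_idem z s' j = idem_a s * idem_a s' * (idem_b z i * idem_b z j)"
    unfolding bi_idem_def using idem_a_commute_idem_b[of s' i] by (metis mult.assoc)
  moreover have "idem_a s * idem_a s' = (if s = s' then idem_a s else (0 :: 'k halg))"
  proof -
    have "s = 0 \<or> s = 1" "s' = 0 \<or> s' = 1" using assms by auto
    then show ?thesis
      using idem_a_facts(2-5)[OF two_three_nonzero(1)] by auto
  qed
  ultimately show ?thesis
    by (simp add: idem_b_mult bi_idem_def)
qed

lemma sum_bi_idem:
  assumes "s \<le> 1"
  shows "(\<Sum>j\<in>{0..5}. bi_idem z (1 - s) j) + (\<Sum>j\<in>{0..5}. bi_idem z s j) = 1"
proof -
  have "(\<Sum>j\<in>{0..5}. bi_idem z s' j) = idem_a s'" for s'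
    by (simp add: bi_idem_def sum_distrib_left[symmetric] sum_idem_b)
  moreover have "s = 0 \<or> s = 1" using assms by auto
  ultimately show ?thesis
    using idem_a_facts(1)[OF two_three_nonzero(1)] by (auto simp: add.commute)
qed

lemma bi_idem_gen_x: "bi_idem z s j * gen_x = gen_x * bi_idem z s (j + 3)"
proof -
  have "bi_idem z s j * gen_x = idem_a s * gen_x * idem_b z (j + 3)"
    by (simp add: bi_idem_def mult.assoc idem_b_gen_x)
  then show ?thesis
    by (simp only: bi_idem_def idem_a_commute(3)[symmetric] mult.assoc)
qed

text \<open>
  Moved to the left through \<open>x\<^sup>n\<close>, which costs at most a sign, \<open>a\<close> and \<open>b\<close> meet the idempotent, on
  which they act by scalars.
\<close>

lemma bi_idem_eigen:
  "\<exists>r. bi_idem z s j * gen_x ^ n * (gen_a ^ i * gen_b ^ l) = r *\<^sub>A (bi_idem z s j * gen_x ^ n)"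
proof -
  let ?E = "bi_idem z s j * gen_x ^ n"
  define Q where "Q y \<longleftrightarrow> (\<exists>r. ?E * y = r *\<^sub>A ?E)" for y
  have one: "Q 1"
    unfolding Q_def by (rule exI[of _ 1]) simp
  have mult: "Q (y * w)" if "Q y" "Q w" for y w
    using that unfolding Q_def by (metis mult.assoc scale_mult_left A.scale_scale)
  have power: "Q (y ^ n)" if "Q y" for y n
    using that by (induction n) (simp_all add: one mult)
  have "Q gen_a"
  proof -
    have sq: "gen_a * gen_a = (1 :: 'k halg)"
      using halg_relations(1)[where ?'k = 'k] by (simp add: power2_eq_square)
    have "?E * gen_a = idem_a s * gen_a * (idem_b z j * gen_x ^ n)"
      unfolding bi_idem_def
      by (metis gen_a_commute(2) gen_a_commute_idem_b mult.assoc)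
    also have "idem_a s * gen_a = (if s = 0 then 1 else - 1) *\<^sub>A (idem_a s :: 'k halg)"
      by (simp add: idem_a_def scale_mult_left algebra_simps sq)
    finally show ?thesis
      unfolding Q_def by (metis bi_idem_def mult.assoc scale_mult_left)
  qed
  moreover have "Q gen_b"
  proof -
    have xb: "gen_x ^ n * gen_b = ((- 1) ^ n :: 'k) *\<^sub>A (gen_b * gen_x ^ n)"
    proof (induction n)
      case (Suc n)
      have "gen_x ^ Suc n * gen_b = gen_x * (gen_x ^ n * gen_b :: 'k halg)"
        by (simp add: mult.assoc)
      also have "\<dots> = ((- 1) ^ n :: 'k) *\<^sub>A (gen_x * gen_b * gen_x ^ n)"
        by (simp add: Suc.IH scale_mult_right mult.assoc)
      also have "gen_x * gen_b = (- 1 :: 'k) *\<^sub>A (gen_b * gen_x)"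
        by (simp add: halg_relations)
      finally show ?case
        by (simp add: scale_mult_left mult.assoc)
    qed simp
    have "?E * gen_b = ((- 1) ^ n) *\<^sub>A (idem_a s * (gen_b ^ 1 * idem_b z j) * gen_x ^ n)"
      unfolding gen_b_commute_idem_b[of 1]
      by (simp add: bi_idem_def mult.assoc xb scale_mult_right)
    also have "\<dots> = ((- 1) ^ n * (1 / z powi j)) *\<^sub>A ?E"
      by (simp add: gen_b_idem_b scale_mult_left scale_mult_right bi_idem_def)
    finally show ?thesis
      unfolding Q_def by blast
  qed
  ultimately show ?thesis
    using power mult unfolding Q_def by blast
qed

lemma bi_idem_monomial:
  "\<exists>r. bi_idem z s j * gen_x ^ n * (gen_x ^ m * gen_a ^ i * gen_b ^ l)
    = r *\<^sub>A (bi_idem z s j * gen_x ^ (n + m))"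
  using bi_idem_eigen[of s j "n + m" i l] by (simp add: mult.assoc power_add)

lemma bi_idem_mult_two_dim: "\<exists>p q. bi_idem z s j * y = p *\<^sub>A bi_idem z s j + q *\<^sub>A (bi_idem z s j * gen_x)"
proof (induction y rule: monomial_induct)
  case (monomial r m i l)
  obtain u where u: "bi_idem z s j * (gen_x ^ m * gen_a ^ i * gen_b ^ l) = u *\<^sub>A (bi_idem z s j * gen_x ^ m)"
    using bi_idem_monomial[of s j 0 m i l] by auto
  have "m = 0 \<or> m = 1" using monomial by auto
  then show ?case
  proof
    assume "m = 0"
    then show ?thesis
      using u by (intro exI[of _ "r * u"] exI[of _ 0]) (simp add: scale_mult_right)
  next
    assume "m = 1"
    then show ?thesis
      using u by (intro exI[of _ 0] exI[of _ "r * u"]) (simp add: scale_mult_right)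
  qed
next
  case (add y w)
  then obtain p q p' q' where
    "bi_idem z s j * y = p *\<^sub>A bi_idem z s j + q *\<^sub>A (bi_idem z s j * gen_x)"
    "bi_idem z s j * w = p' *\<^sub>A bi_idem z s j + q' *\<^sub>A (bi_idem z s j * gen_x)"
    by blast
  then show ?case
    by (intro exI[of _ "p + p'"] exI[of _ "q + q'"]) (simp add: distrib_left A.scale_left_distrib)
qed

lemma algR_subalgebra: "subalgebra (algR :: 'k halg set)"
  unfolding algR_def subalgebra_def A.subspace_def by blast

lemma gen_x_power_in_algR: "gen_x ^ n \<in> (algR :: 'k halg set)"
proof (induction n)
  case 0
  show ?case using algR_subalgebra by (simp add: subalgebra_def)
next
  case (Suc n)
  have "gen_x \<in> (algR :: 'k halg set)"
    unfolding algR_def by blast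
  with Suc show ?case using algR_subalgebra by (simp add: subalgebra_def)
qed

text \<open>
  A monomial \<open>x\<^sup>n a\<^sup>i b\<^sup>j\<close> acts on \<open>e\<^sub>s\<^sub>,\<^sub>t x\<^sup>m\<close> as a multiple of \<open>x\<^sup>n \<in> R\<close>, so the right ideal
  generated by \<open>e\<^sub>s\<^sub>,\<^sub>t x\<^sup>m\<close> is no larger than its translate of \<open>R\<close>.
\<close>

lemma Nsub_eq_right_ideal: "Nsub z s t m = range ((*) (bi_idem z s t * gen_x ^ m))"
proof -
  have "\<exists>r\<in>algR. bi_idem z s t * gen_x ^ m * y = bi_idem z s t * gen_x ^ m * r" for y
  proof (induction y rule: monomial_induct)
    case (monomial r n i j)
    obtain u where u: "bi_idem z s t * gen_x ^ m * (gen_x ^ n * gen_a ^ i * gen_b ^ j)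
        = u *\<^sub>A (bi_idem z s t * gen_x ^ (m + n))"
      using bi_idem_monomial by blast
    have "(r * u) *\<^sub>A gen_x ^ n \<in> (algR :: 'k halg set)"
      using algR_subalgebra gen_x_power_in_algR by (simp add: subalgebra_def A.subspace_def)
    moreover have "bi_idem z s t * gen_x ^ m * (r *\<^sub>A (gen_x ^ n * gen_a ^ i * gen_b ^ j))
        = bi_idem z s t * gen_x ^ m * ((r * u) *\<^sub>A gen_x ^ n)"
      using u by (simp add: scale_mult_right power_add mult.assoc)
    ultimately show ?case by blast
  next
    case (add y w)
    then obtain p q where "p \<in> algR" "q \<in> algR"
      "bi_idem z s t * gen_x ^ m * y = bi_idem z s t * gen_x ^ m * p"
      "bi_idem z s t * gen_x ^ m * w = bi_idem z s t * gen_x ^ m * q"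
      by blast
    moreover from this have "p + q \<in> algR"
      using algR_subalgebra by (simp add: subalgebra_def A.subspace_def)
    ultimately show ?case by (intro bexI[of _ "p + q"]) (simp_all add: distrib_left)
  qed
  then show ?thesis
    unfolding Nsub_def bi_idem_def by fastforce
qed

lemma subspace_Nsub: "A.subspace (Nsub z s t m)"
  unfolding A.subspace_def
proof (intro conjI ballI allI)
  show "0 \<in> Nsub z s t m"
    unfolding Nsub_eq_right_ideal by (rule range_eqI[of _ _ 0]) simp
next
  fix v w assume "v \<in> Nsub z s t m" "w \<in> Nsub z s t m"
  then show "v + w \<in> Nsub z s t m"
    unfolding Nsub_eq_right_ideal by (auto simp: distrib_left[symmetric])
next
  fix r v assume "v \<in> Nsub z s t m"
  then show "r *\<^sub>A v \<in> Nsub z s t m"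
    unfolding Nsub_eq_right_ideal by (auto simp: scale_mult_right[symmetric])
qed

section \<open>Nondegeneracy\<close>

lemma lambda_bi_idem: "lambda (bi_idem z s t) = 0" "lambda (bi_idem z s t * gen_x) \<noteq> 0"
proof -
  have a: "lambda (gen_x ^ m * idem_a s * gen_b ^ i :: 'k halg) = (if m = 1 \<and> i = 3 then 1 / 2 else 0)"
    if "m \<le> 1" "i \<le> 5" for m i
    using lambda_monomial[of m 0 i, where ?'k = 'k] lambda_monomial[of m 1 i, where ?'k = 'k] that
    by (auto simp: idem_a_def scale_mult_left scale_mult_right distrib_left distrib_right
      right_diff_distrib left_diff_distrib lambda_simps)
  have b: "lambda (gen_x ^ m * bi_idem z s j) = 1 / 6 * (if m = 1 then (z powi j) ^ 3 * (1 / 2) else 0)"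
    if "m \<le> 1" for m j
  proof -
    have "lambda (gen_x ^ m * bi_idem z s j)
        = 1 / 6 * (\<Sum>i\<le>5. (z powi j) ^ i * lambda (gen_x ^ m * idem_a s * gen_b ^ i))"
      by (simp add: bi_idem_def idem_b_altdef scale_mult_right sum_distrib_left lambda_simps mult.assoc)
    also have "\<dots> = 1 / 6 * (\<Sum>i\<le>5::nat. if i = 3 then (if m = 1 then (z powi j) ^ 3 * (1 / 2) else 0) else 0)"
      using that by (intro arg_cong[where f = "(*) (1 / 6)"] sum.cong) (auto simp: a)
    also have "\<dots> = 1 / 6 * (if m = 1 then (z powi j) ^ 3 * (1 / 2) else 0)"
      by (subst sum.delta) simp_all
    finally show ?thesis .
  qed
  show "lambda (bi_idem z s t) = 0"
    using b[of 0 t] by simp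
  have "lambda (bi_idem z s t * gen_x) = 1 / 6 * ((z powi (t + 3)) ^ 3 * (1 / 2))"
    using b[of 1 "t + 3"] by (simp only: bi_idem_gen_x power_one_right simp_thms if_True order.refl)
  also have "\<dots> \<noteq> 0"
    unfolding mult_eq_0_iff divide_eq_0_iff de_Morgan_disj
    using root_nonzero two_three_nonzero(1) six_nonzero by simp
  finally show "lambda (bi_idem z s t * gen_x) \<noteq> 0" .
qed

lemma nakayama_bi_idem: "nakayama (bi_idem z s t) (bi_idem z s (t + 3))"
  unfolding bi_idem_def by (intro nakayama_mult nakayama_idem_a nakayama_idem_b)

text \<open>
  In the plane \<open>e\<^sub>s\<^sub>,\<^sub>j A\<close>, spanned by \<open>e\<^sub>s\<^sub>,\<^sub>j\<close> and \<open>e\<^sub>s\<^sub>,\<^sub>j x\<close>, the functional \<open>\<lambda>\<close> reads off the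
  second coordinate; right multiplication by \<open>x\<close> turns the first coordinate into the second.
\<close>

lemma eq_zero_if_lambda_zero:
  assumes "\<And>s j. lambda (bi_idem z s j * g) = 0"
    and "\<And>s j. lambda (bi_idem z s j * g * gen_x) = 0"
  shows "g = 0"
proof -
  have E: "bi_idem z s j * g = 0" for s j
  proof -
    let ?E = "bi_idem z s j"
    obtain p q where pq: "?E * g = p *\<^sub>A ?E + q *\<^sub>A (?E * gen_x)"
      using bi_idem_mult_two_dim by blast
    have "q * lambda (?E * gen_x) = 0"
      using assms(1)[of s j] by (simp add: pq lambda_simps lambda_bi_idem)
    then have q: "q = 0"
      using lambda_bi_idem(2) by simp
    have "p * lambda (?E * gen_x) = 0"
      using assms(2)[of s j] by (simp add: pq q scale_mult_left lambda_simps)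
    then have "p = 0"
      using lambda_bi_idem(2) by simp
    with pq q show ?thesis by simp
  qed
  have "((\<Sum>j\<in>{0..5}. bi_idem z (1 - 0) j) + (\<Sum>j\<in>{0..5}. bi_idem z 0 j)) * g = 0"
    by (simp only: distrib_right sum_distrib_right E sum.neutral_const add_0_left)
  then show ?thesis
    by (simp only: sum_bi_idem mult_1_left zero_le_one)
qed

lemma lambda_nondegenerate_right:
  assumes "\<And>y. lambda (y * g) = 0"
  shows "g = (0 :: 'k halg)"
proof (rule eq_zero_if_lambda_zero)
  fix s j
  show "lambda (bi_idem z s j * g) = 0"
    by (rule assms)
  have "lambda (bi_idem z s j * g * gen_x) = - lambda (gen_x * (bi_idem z s j * g))"
    using nakayama_gens(3)[where ?'k = 'k] by (simp add: nakayama_def lambda_simps)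
  then show "lambda (bi_idem z s j * g * gen_x) = 0"
    using assms[of "gen_x * bi_idem z s j"] by (simp add: mult.assoc)
qed

lemma lambda_nondegenerate_left:
  assumes "\<And>y. lambda (g * y) = 0"
  shows "g = (0 :: 'k halg)"
proof -
  have "lambda (bi_idem z s j * (g * y)) = 0" for s j y
    using nakayama_bi_idem[of s j] assms[of "y * bi_idem z s (j + 3)"]
    by (simp add: nakayama_def mult.assoc)
  from this[of _ _ 1] this[of _ _ gen_x] show ?thesis
    by (intro eq_zero_if_lambda_zero) (simp_all add: mult.assoc)
qed

text \<open>
  The two nondegeneracy statements for \<open>\<lambda>\<close> pass to the form because \<open>S\<close> is injective (first
  argument) and surjective (second argument).
\<close>

lemma form_nondegenerate:
  fixes h :: "'k halg"
  shows "(\<forall>y. form h y = 0) \<longleftrightarrow> h = 0" "(\<forall>y. form y h = 0) \<longleftrightarrow> h = 0"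
proof -
  have zero: "antipode (0 :: 'k halg) = 0"
    using antipode_simps(2)[of 0 1] by simp
  show "(\<forall>y. form h y = 0) \<longleftrightarrow> h = 0"
  proof
    assume "\<forall>y. form h y = 0"
    then have "antipode h = 0"
      by (intro lambda_nondegenerate_right) (simp add: form_def)
    then show "h = 0"
      by (metis antipode_order_four zero)
  qed (simp add: form_def zero lambda_simps)
  show "(\<forall>y. form y h = 0) \<longleftrightarrow> h = 0"
  proof
    assume *: "\<forall>y. form y h = 0"
    show "h = 0"
    proof (rule lambda_nondegenerate_left)
      fix y
      show "lambda (h * y) = 0"
        using *[rule_format, of "antipode (antipode (antipode y))"]
        by (simp add: form_def antipode_order_four)
    qed
  qed (simp add: form_def zero lambda_simps)
qed

section \<open>The orthogonals\<close>

text \<open>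
  With \<open>\<sigma> = (-1)\<^sup>s\<^sup>+\<^sup>1\<close>, the antipode acts on the second index by \<open>t \<mapsto> \<sigma> t\<close> and \<open>\<nu>\<close> by
  \<open>t \<mapsto> t + 3\<close>.  The two conditions hold because \<open>\<sigma>\<^sup>2 = 1\<close>, \<open>3 \<sigma> = 3\<close> and \<open>3 + 3 = 0\<close> modulo \<open>6\<close>.
\<close>

lemma adjoint_pair_bi_idem:
  assumes "s \<le> 1"
  shows "adjoint_pair (bi_idem z s t) (bi_idem z s ((- 1) ^ (s + 1) * t + 3))"
proof (rule adjoint_pairI)
  have s: "s = 0 \<or> s = 1" using assms by auto
  have "[(- 1) ^ (s + 1) * ((- 1) ^ (s + 1) * t + 3) = t + 3] (mod 6)"
    using s by (auto simp: cong_iff_dvd_diff)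
  then have "antipode (bi_idem z s ((- 1) ^ (s + 1) * t + 3)) = bi_idem z s (t + 3)"
    unfolding antipode_bi_idem[OF assms] by (rule bi_idem_cong)
  then show "nakayama (bi_idem z s t) (antipode (bi_idem z s ((- 1) ^ (s + 1) * t + 3)))"
    using nakayama_bi_idem by simp
  have "bi_idem z s ((- 1) ^ (s + 1) * t + 3 + 3) = bi_idem z s ((- 1) ^ (s + 1) * t)"
    by (rule bi_idem_cong) (simp add: cong_iff_dvd_diff)
  then show "nakayama (bi_idem z s ((- 1) ^ (s + 1) * t + 3)) (antipode (bi_idem z s t))"
    unfolding antipode_bi_idem[OF assms]
    using nakayama_bi_idem[of s "(- 1) ^ (s + 1) * t + 3"] by simp
qed

lemma perp_right_ideal:
  assumes "adjoint_pair g h"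
  shows "left_perp (range ((*) g)) = {v. h * v = 0}" "right_perp (range ((*) g)) = {v. h * v = 0}"
  using assms by (simp_all add: left_perp_def right_perp_def adjoint_pair_def form_nondegenerate)

text \<open>
  The adjoint of \<open>e\<^sub>s\<^sub>,\<^sub>t x\<^sup>m\<close> is \<open>S(x)\<^sup>m\<close> times the adjoint idempotent; as \<open>S(x) = - b\<^sup>3 x\<close> with
  \<open>b\<close> invertible, \<open>S(x)\<close> may be replaced by \<open>x\<close> in the annihilator.
\<close>

lemma perp_Nsub:
  assumes "s \<le> 1" "m \<le> 1"
  shows "left_perp (Nsub z s t m) = {v. gen_x ^ m * (bi_idem z s ((- 1) ^ (s + 1) * t + 3) * v) = 0}"
    "right_perp (Nsub z s t m) = {v. gen_x ^ m * (bi_idem z s ((- 1) ^ (s + 1) * t + 3) * v) = 0}"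
proof -
  let ?E = "bi_idem z s ((- 1) ^ (s + 1) * t + 3)"
  have adj: "adjoint_pair (bi_idem z s t * gen_x ^ m) (antipode gen_x ^ m * ?E)"
    using assms(1) by (intro adjoint_pair_mult adjoint_pair_power adjoint_pair_gen_x adjoint_pair_bi_idem)
  have "antipode gen_x ^ m * w = 0 \<longleftrightarrow> gen_x ^ m * w = 0" for w :: "'k halg"
  proof -
    have "gen_x * w = 0" if "gen_b ^ 3 * (gen_x * w) = 0"
    proof -
      have "gen_b ^ 3 * (gen_b ^ 3 * (gen_x * w)) = gen_x * w"
        by (simp add: mult.assoc[symmetric] power_add[symmetric] halg_relations)
      with that show ?thesis by simp
    qed
    moreover have "m = 0 \<or> m = 1" using assms(2) by auto
    ultimately show ?thesis
      by (auto simp: antipode_simps mult.assoc)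
  qed
  then show "left_perp (Nsub z s t m) = {v. gen_x ^ m * (?E * v) = 0}"
    "right_perp (Nsub z s t m) = {v. gen_x ^ m * (?E * v) = 0}"
    unfolding Nsub_eq_right_ideal perp_right_ideal[OF adj] by (simp_all add: mult.assoc)
qed

text \<open>
  \<open>S(d)\<close> is the inverse of \<open>S(c)\<close>, the adjoint of \<open>c\<close>.
\<close>

lemma perp_translate:
  fixes c d :: "'k halg"
  assumes "c \<in> algR" "c * d = 1" "d * c = 1"
  shows "left_perp ((*) c ` W) = (*) (antipode d) ` left_perp W"
    "right_perp ((*) c ` W) = (*) (antipode d) ` right_perp W"
proof -
  have adj: "adjoint_pair c (antipode c)"
    using assms(1) by (rule adjoint_pair_algR)
  have inv: "antipode c * (antipode d * v) = v" "antipode d * (antipode c * v) = v" for v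
    using assms(2,3) by (metis antipode_simps(6,7) mult.assoc mult_1_left)+
  have "left_perp ((*) c ` W) = {v. antipode c * v \<in> left_perp W}"
    "right_perp ((*) c ` W) = {v. antipode c * v \<in> right_perp W}"
    using adj by (auto simp: left_perp_def right_perp_def adjoint_pair_def)
  moreover have "{v. antipode c * v \<in> X} = (*) (antipode d) ` X" for X
  proof (intro set_eqI iffI)
    fix v assume "v \<in> {v. antipode c * v \<in> X}"
    then show "v \<in> (*) (antipode d) ` X"
      using inv(2)[of v] by (intro image_eqI[of _ _ "antipode c * v"]) simp_all
  qed (auto simp: inv(1))
  ultimately show "left_perp ((*) c ` W) = (*) (antipode d) ` left_perp W"
    "right_perp ((*) c ` W) = (*) (antipode d) ` right_perp W"
    by simp_all
qed

lemma Nsub_zero_iff: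
  assumes "s \<le> 1"
  shows "w \<in> Nsub z s t 0 \<longleftrightarrow> bi_idem z s t * w = w"
proof
  assume "w \<in> Nsub z s t 0"
  then show "bi_idem z s t * w = w"
    unfolding Nsub_eq_right_ideal using bi_idem_mult[OF assms assms, of t t]
    by (auto simp: mult.assoc[symmetric])
next
  assume "bi_idem z s t * w = w"
  then show "w \<in> Nsub z s t 0"
    unfolding Nsub_eq_right_ideal by (intro range_eqI[of _ _ w]) simp
qed

lemma cong_mod_six_iff: "i \<in> {0..5} \<Longrightarrow> j \<in> {0..5} \<Longrightarrow> [i = j] (mod 6) \<longleftrightarrow> i = j" for i j :: int
  by (simp add: cong_def)

text \<open>
  Part of the Peirce decomposition: multiplication by \<open>e\<^sub>s\<^sub>,\<^sub>i\<close> projects a sum to its \<open>i\<close>-th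
  summand, so the sum is direct.  Describing it as the fixed space of an idempotent
  makes the summands easy to compare with annihilators.
\<close>

lemma direct_sum_family_bi_idem:
  assumes "s \<le> 1" and "J \<subseteq> {0..5}"
  shows "direct_sum_family {w. (\<Sum>j\<in>J. bi_idem z s j) * w = w} J (\<lambda>j. Nsub z s j 0)"
proof -
  have fin: "finite J" using assms(2) finite_subset by blast
  have project: "bi_idem z s i * (\<Sum>j\<in>J. u j) = u i"
    if "\<forall>j\<in>J. u j \<in> Nsub z s j 0" "i \<in> J" for u i
  proof -
    have "bi_idem z s i * u j = (if j = i then u i else 0)" if "j \<in> J" for j
    proof -
      have "bi_idem z s i * u j = bi_idem z s i * bi_idem z s j * u j"
        using \<open>\<forall>j\<in>J. u j \<in> Nsub z s j 0\<close> that by (simp add: Nsub_zero_iff[OF assms(1)] mult.assoc)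
      moreover have "[i = j] (mod 6) \<longleftrightarrow> i = j"
        using assms(2) that \<open>i \<in> J\<close> by (intro cong_mod_six_iff) auto
      ultimately show ?thesis
        using \<open>\<forall>j\<in>J. u j \<in> Nsub z s j 0\<close> that
        by (auto simp: bi_idem_mult[OF assms(1) assms(1)] Nsub_zero_iff[OF assms(1)])
    qed
    then show ?thesis
      using fin that(2) by (simp add: sum_distrib_left)
  qed
  show ?thesis
    unfolding direct_sum_family_def
  proof (intro conjI ballI subspace_Nsub fin)
    show "{w. (\<Sum>j\<in>J. bi_idem z s j) * w = w} = {\<Sum>i\<in>J. u i |u. \<forall>i\<in>J. u i \<in> Nsub z s i 0}"
    proof (intro set_eqI iffI)
      fix w assume "w \<in> {w. (\<Sum>j\<in>J. bi_idem z s j) * w = w}"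
      then have "w = (\<Sum>j\<in>J. bi_idem z s j * w)"
        by (simp add: sum_distrib_right)
      moreover have "bi_idem z s j * w \<in> Nsub z s j 0" for j
        unfolding Nsub_eq_right_ideal by simp
      ultimately show "w \<in> {\<Sum>i\<in>J. u i |u. \<forall>i\<in>J. u i \<in> Nsub z s i 0}"
        by blast
    next
      fix w assume "w \<in> {\<Sum>i\<in>J. u i |u. \<forall>i\<in>J. u i \<in> Nsub z s i 0}"
      then show "w \<in> {w. (\<Sum>j\<in>J. bi_idem z s j) * w = w}"
        using project by (auto simp: sum_distrib_right intro!: sum.cong)
    qed
    show "\<forall>u. (\<forall>i\<in>J. u i \<in> Nsub z s i 0) \<and> (\<Sum>i\<in>J. u i) = 0 \<longrightarrow> (\<forall>i\<in>J. u i = 0)"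
      using project by (metis mult_zero_right)
  qed
qed

lemma sum_bi_idem_idempotent:
  assumes "s \<le> 1" and "J \<subseteq> {0..5}"
  shows "(\<Sum>j\<in>J. bi_idem z s j) * (\<Sum>j\<in>J. bi_idem z s j) = (\<Sum>j\<in>J. bi_idem z s j)"
proof -
  have "(\<Sum>j\<in>J. bi_idem z s j) \<in> {\<Sum>i\<in>J. u i |u. \<forall>i\<in>J. u i \<in> Nsub z s i 0}"
    using bi_idem_mult[OF assms(1) assms(1)] by (auto simp: Nsub_zero_iff[OF assms(1)])
  also have "\<dots> = {w. (\<Sum>j\<in>J. bi_idem z s j) * w = w}"
    using direct_sum_family_bi_idem[OF assms] by (simp add: direct_sum_family_def)
  finally show ?thesis by simp
qed

text \<open>
  \<open>1\<close> is the sum of the orthogonal idempotents \<open>P\<close> (all \<open>e\<^sub>1\<^sub>-\<^sub>s\<^sub>,\<^sub>j\<close>), \<open>Q\<close> (the \<open>e\<^sub>s\<^sub>,\<^sub>j\<close> with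
  \<open>j \<noteq> k\<close> modulo \<open>6\<close>) and \<open>e\<^sub>s\<^sub>,\<^sub>k\<close>, so the annihilator of \<open>e\<^sub>s\<^sub>,\<^sub>k\<close> is \<open>P A \<oplus> Q A\<close>.
\<close>

lemma annihilator_decomposition:
  assumes "s \<le> 1"
  shows "\<exists>U V. direct_sum_family U {0..5} (\<lambda>j. Nsub z (1 - s) j 0) \<and>
    direct_sum_family V {j \<in> {0..5}. \<not> [j = k] (mod 6)} (\<lambda>j. Nsub z s j 0) \<and>
    direct_sum {v. bi_idem z s k * v = 0} U V"
proof -
  define J where "J = {j \<in> {0..5}. \<not> [j = k] (mod 6)}"
  define P where "P = (\<Sum>j\<in>{0..5}. bi_idem z (1 - s) j)"
  define Q where "Q = (\<Sum>j\<in>J. bi_idem z s j)"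
  let ?E = "bi_idem z s k"
  have s: "1 - s \<le> 1" "1 - s \<noteq> s" using assms by presburger+
  have "bi_idem z (1 - s) i * bi_idem z s j = 0" "bi_idem z s j * bi_idem z (1 - s) i = 0" for i j
    using s(2) bi_idem_mult[OF s(1) assms] bi_idem_mult[OF assms s(1)] by metis+
  moreover have "?E * bi_idem z s j = 0" if "j \<in> J" for j
    using that bi_idem_mult[OF assms assms] by (simp add: J_def cong_sym_eq)
  ultimately have zeros: "P * Q = 0" "?E * P = 0" "?E * Q = 0"
    by (simp_all add: P_def Q_def sum_distrib_left sum_distrib_right)
  have complement: "P + Q + ?E = 1"
  proof -
    \<comment> \<open>The index \<open>k\<close> need not lie between \<open>0\<close> and \<open>5\<close>; its residue is the one missing from \<open>J\<close>.\<close>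
    have k: "k mod 6 \<in> {0..5}" "[k mod 6 = k] (mod 6)"
      by (simp_all add: cong_def)
    have J: "{0..5} = insert (k mod 6) J" "k mod 6 \<notin> J"
      using k cong_mod_six_iff[OF _ k(1)] by (auto simp: J_def cong_def)
    have "finite J"
      unfolding J_def by (rule finite_subset[of _ "{0..5}"]) auto
    have "(\<Sum>j\<in>{0..5}. bi_idem z s j) = bi_idem z s (k mod 6) + Q"
      unfolding J(1) Q_def by (rule sum.insert[OF \<open>finite J\<close> J(2)])
    with sum_bi_idem[OF assms] show ?thesis
      by (simp add: P_def bi_idem_cong[OF k(2)] algebra_simps)
  qed
  have "direct_sum {v. ?E * v = 0} {w. P * w = w} {w. Q * w = w}"
    unfolding direct_sum_def
  proof (intro conjI)
    show "A.subspace {w. P * w = w}" "A.subspace {w. Q * w = w}"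
      by (auto simp: A.subspace_def distrib_left scale_mult_right)
    have idem: "P * P = P" "Q * Q = Q"
      unfolding P_def Q_def
      using s assms by (auto simp: J_def intro!: sum_bi_idem_idempotent)
    show "{v. ?E * v = 0} = {u + v |u v. u \<in> {w. P * w = w} \<and> v \<in> {w. Q * w = w}}"
    proof (intro set_eqI iffI)
      fix v assume "v \<in> {v. ?E * v = 0}"
      then have "v = P * v + Q * v"
        using complement by (metis (mono_tags) add.right_neutral distrib_right mem_Collect_eq mult_1_left)
      moreover have "P * (P * v) = P * v" "Q * (Q * v) = Q * v"
        by (simp_all add: idem mult.assoc[symmetric])
      ultimately show "v \<in> {u + v |u v. u \<in> {w. P * w = w} \<and> v \<in> {w. Q * w = w}}"
        by blast
    next
      fix w assume "w \<in> {u + v |u v. u \<in> {w. P * w = w} \<and> v \<in> {w. Q * w = w}}"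
      then obtain u v where w: "w = u + v" "P * u = u" "Q * v = v"
        by blast
      have "?E * w = ?E * P * u + ?E * Q * v"
        by (simp add: w distrib_left mult.assoc)
      then show "w \<in> {v. ?E * v = 0}"
        by (simp add: zeros)
    qed
    have "w = 0" if "P * w = w" "Q * w = w" for w
      using that zeros(1) by (metis mult.assoc mult_zero_left)
    then show "{w. P * w = w} \<inter> {w. Q * w = w} = {0}"
      by auto
  qed
  moreover have "direct_sum_family {w. P * w = w} {0..5} (\<lambda>j. Nsub z (1 - s) j 0)"
    unfolding P_def by (rule direct_sum_family_bi_idem) (use s in auto)
  moreover have "direct_sum_family {w. Q * w = w} J (\<lambda>j. Nsub z s j 0)"
    unfolding Q_def by (rule direct_sum_family_bi_idem) (use assms in \<open>auto simp: J_def\<close>)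
  ultimately show ?thesis
    unfolding J_def by blast
qed

text \<open>
  The projection \<open>v \<mapsto> e\<^sub>s\<^sub>,\<^sub>k v\<close> splits off the annihilator of \<open>e\<^sub>s\<^sub>,\<^sub>k\<close>.  What remains is the kernel of
  \<open>x\<^sup>m\<close> in the plane spanned by \<open>e\<^sub>s\<^sub>,\<^sub>k\<close> and \<open>e\<^sub>s\<^sub>,\<^sub>k x\<close>: it is zero for \<open>m = 0\<close>, and the line
  through \<open>e\<^sub>s\<^sub>,\<^sub>k x\<close> for \<open>m = 1\<close>, since \<open>x e\<^sub>s\<^sub>,\<^sub>k x = 0\<close> and \<open>x e\<^sub>s\<^sub>,\<^sub>k \<noteq> 0\<close>.
\<close>

lemma gen_x_annihilator_decomposition:
  assumes "s \<le> 1" "m \<le> 1"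
  shows "direct_sum {v. gen_x ^ m * (bi_idem z s k * v) = 0} {v. bi_idem z s k * v = 0} (Nsub z s k (2 - m))"
proof -
  let ?E = "bi_idem z s k"
  have idem: "?E * (?E * v) = ?E * v" for v
    using bi_idem_mult[OF assms(1) assms(1), of k k] by (simp add: mult.assoc[symmetric])
  have EN: "?E * w = w" if "w \<in> Nsub z s k n" for w n
    using that unfolding Nsub_eq_right_ideal by (auto simp: mult.assoc idem)
  have kills: "gen_x ^ m * w = 0" if N: "w \<in> Nsub z s k (2 - m)" for w
  proof -
    obtain y where w: "w = ?E * gen_x ^ (2 - m) * y"
      using N unfolding Nsub_eq_right_ideal by blast
    have "gen_x * ?E * gen_x = 0"
      by (simp add: bi_idem_gen_x gen_x_square mult.assoc)
    moreover have "m = 0 \<or> m = 1" using assms(2) by auto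
    ultimately show ?thesis
      by (auto simp: w halg_relations mult.assoc[symmetric])
  qed
  have memb: "?E * v \<in> Nsub z s k (2 - m)" if "gen_x ^ m * (?E * v) = 0" for v
  proof -
    obtain p q where pq: "?E * v = p *\<^sub>A ?E + q *\<^sub>A (?E * gen_x)"
      using bi_idem_mult_two_dim by blast
    have "m = 0 \<or> m = 1" using assms(2) by auto
    then show ?thesis
    proof
      assume "m = 0"
      then show ?thesis
        using that A.subspace_0[OF subspace_Nsub] by simp
    next
      assume m: "m = 1"
      have "gen_x * (?E * gen_x) = 0"
        by (simp add: bi_idem_gen_x gen_x_square)
      with that have "p *\<^sub>A (gen_x * ?E) = 0"
        by (simp add: m pq distrib_left scale_mult_right)
      \<comment> \<open>Up to sign, \<open>\<lambda>\<close> takes the same value here as on \<open>e\<^sub>s\<^sub>,\<^sub>k x\<close>, where it is nonzero.\<close>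
      moreover have "gen_x * ?E \<noteq> 0"
      proof
        assume "gen_x * ?E = 0"
        moreover have "lambda (gen_x * ?E) = - lambda (?E * gen_x)"
          using nakayama_gens(3)[where ?'k = 'k] by (simp add: nakayama_def lambda_simps)
        ultimately show False
          using lambda_bi_idem(2) by (simp add: lambda_simps)
      qed
      ultimately have "p = 0" by simp
      then have "?E * v = ?E * gen_x ^ (2 - m) * (q *\<^sub>A 1)"
        by (simp add: m pq scale_mult_right)
      then show ?thesis
        unfolding Nsub_eq_right_ideal by blast
    qed
  qed
  show ?thesis
    unfolding direct_sum_def
  proof (intro conjI subspace_Nsub)
    show "A.subspace {v. ?E * v = 0}"
      by (auto simp: A.subspace_def distrib_left scale_mult_right)
    show "{v. gen_x ^ m * (?E * v) = 0} = {u + v |u v. u \<in> {v. ?E * v = 0} \<and> v \<in> Nsub z s k (2 - m)}"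
    proof (intro set_eqI iffI)
      fix v assume "v \<in> {v. gen_x ^ m * (?E * v) = 0}"
      then have "?E * v \<in> Nsub z s k (2 - m)"
        using memb by simp
      moreover have "?E * (v - ?E * v) = 0"
        by (simp add: right_diff_distrib idem)
      moreover have "v = (v - ?E * v) + ?E * v"
        by simp
      ultimately show "v \<in> {u + v |u v. u \<in> {v. ?E * v = 0} \<and> v \<in> Nsub z s k (2 - m)}"
        by blast
    next
      fix w assume "w \<in> {u + v |u v. u \<in> {v. ?E * v = 0} \<and> v \<in> Nsub z s k (2 - m)}"
      then show "w \<in> {v. gen_x ^ m * (?E * v) = 0}"
        using kills by (auto simp: distrib_left EN)
    qed
    show "{v. ?E * v = 0} \<inter> Nsub z s k (2 - m) = {0}"
      using EN A.subspace_0[OF subspace_Nsub] by auto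
  qed
qed

end

theorem theorem35:
  fixes \<zeta> :: "'k::field" and c d :: "'k halg" and s m :: nat and t :: int
  assumes "primitive_root_of_unity 6 \<zeta>"
    and "c \<in> algR" and "c * d = 1" and "d * c = 1"
    and "m \<le> 1" and "s \<le> 1" and "0 \<le> t" and "t \<le> 5"
  shows "left_perp (Nsub \<zeta> s t m) = right_perp (Nsub \<zeta> s t m) \<and>
    left_perp ((*) c ` Nsub \<zeta> s t m) = right_perp ((*) c ` Nsub \<zeta> s t m) \<and>
    (\<exists>U V. direct_sum_family U {0..5} (\<lambda>j::int. Nsub \<zeta> (1 - s) j 0) \<and>
       direct_sum_family V {j \<in> {0..5}. \<not> [j = (- 1) ^ (s + 1) * t + 3] (mod 6)} (\<lambda>j. Nsub \<zeta> s j 0) \<and>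
       direct_sum (left_perp (Nsub \<zeta> s t 0)) U V) \<and>
    direct_sum (left_perp (Nsub \<zeta> s t m)) (left_perp (Nsub \<zeta> s t 0))
      (Nsub \<zeta> s ((- 1) ^ (s + 1) * t + 3) (2 - m)) \<and>
    left_perp ((*) c ` Nsub \<zeta> s t m) = (*) (antipode d) ` left_perp (Nsub \<zeta> s t m)"
proof -
  note root = assms(1) and translate = perp_translate[OF assms(1-4)]
  let ?k = "(- 1) ^ (s + 1) * t + 3"
  have zero: "left_perp (Nsub \<zeta> s t 0) = {v. bi_idem \<zeta> s ?k * v = 0}"
    using perp_Nsub(1)[OF root \<open>s \<le> 1\<close>, of 0 t] by simp
  have "left_perp (Nsub \<zeta> s t m) = right_perp (Nsub \<zeta> s t m)"
    by (simp only: perp_Nsub[OF root \<open>s \<le> 1\<close> \<open>m \<le> 1\<close>])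
  moreover have "direct_sum (left_perp (Nsub \<zeta> s t m)) (left_perp (Nsub \<zeta> s t 0)) (Nsub \<zeta> s ?k (2 - m))"
    unfolding zero perp_Nsub(1)[OF root \<open>s \<le> 1\<close> \<open>m \<le> 1\<close>]
    by (rule gen_x_annihilator_decomposition[OF root \<open>s \<le> 1\<close> \<open>m \<le> 1\<close>])
  ultimately show ?thesis
    using annihilator_decomposition[OF root \<open>s \<le> 1\<close>, of ?k] translate[of "Nsub \<zeta> s t m"]
    unfolding zero by (intro conjI) simp_all
qed

end
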